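(* For $x\in(0,\pi/4]$ let $U=(\cos^3x+i\sin^3x)\sigma_0\otimes\sigma_0+i\sin x\cos x\,e^{-ix}\sum_{j=1}^3\sigma_j\otimes\sigma_j$. Let $x_0\approx0.1018$ be the (positive) root of $$H(\cos^22x_0,\sin^22x_0)=H(\cos^6x_0+\sin^6x_0,\cos^2x_0\sin^2x_0,\cos^2x_0\sin^2x_0,\cos^2x_0\sin^2x_0).$$ (i) If $0<x\le x_0$, then $K_E(U)=H(\cos^22x,\sin^22x)$ ebits, attained by the input state $|00\rangle_{AR_A}\otimes|11\rangle_{BR_B}$. (ii) If $x_0\le x\le\pi/4$, then $K_E(U)=H(\cos^6x+\sin^6x,\cos^2x\sin^2x,\cos^2x\sin^2x,\cos^2x\sin^2x)$ ebits, attained by the input state $\frac{1}{\sqrt2}(|00\rangle+|11\rangle)_{AR_A}\otimes\frac{1}{\sqrt2}(|00\rangle+|11\rangle)_{BR_B}$.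
   Context: Pauli matrices: $\sigma_0=I$, $\sigma_1=\begin{pmatrix}0&1\\1&0\end{pmatrix}$, $\sigma_2=\begin{pmatrix}0&-i\\i&0\end{pmatrix}$, $\sigma_3=\begin{pmatrix}1&0\\0&-1\end{pmatrix}$; $U$ acts on qubits $A,B$. The entangling power is $K_E(U)=\max E\big(U(|\phi\rangle_{AR_A}\otimes|\psi\rangle_{BR_B})\big)$, the maximum over pure states on $AR_A$ and $BR_B$ with arbitrary finite-dimensional ancillas $R_A,R_B$ ($U$ acting on $A,B$), where $E(|\chi\rangle)=S(\mathrm{Tr}_{AR_A}|\chi\rangle\langle\chi|)$ is the von Neumann entropy, base-2 logarithm (ebits). $H(p_1,\dots,p_k)=-\sum_ip_i\log_2p_i$ is the Shannon entropy. *)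

theory Defs
  imports Complex_Main "Jordan_Normal_Form.Char_Poly"
begin

definition eta :: "real \<Rightarrow> real" where
  "eta t = (if t \<le> 0 then 0 else - t * log 2 t)"

definition shannon :: "real list \<Rightarrow> real" where
  "shannon ps = sum_list (map eta ps)"

(* von Neumann entropy (base 2) of a density matrix rho: -sum lambda log2 lambda over the
   eigenvalues of rho counted with (algebraic) multiplicity, i.e. the roots of the
   characteristic polynomial with their orders.  For a density matrix (Hermitian, PSD)
   all eigenvalues are real and nonnegative. *)
definition vn_entropy :: "complex mat \<Rightarrow> real" where
  "vn_entropy rho =
     (\<Sum>l \<in> {l. poly (char_poly rho) l = 0}. real (order l (char_poly rho)) * eta (Re l))"

definition pauli :: "nat \<Rightarrow> complex mat" where
  "pauli j = (if j = 1 then mat_of_rows_list 2 [[0, 1], [1, 0]]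
              else if j = 2 then mat_of_rows_list 2 [[0, -\<i>], [\<i>, 0]]
              else if j = 3 then mat_of_rows_list 2 [[1, 0], [0, -1]]
              else mat_of_rows_list 2 [[1, 0], [0, 1]])"

(* tensor product of two 2x2 matrices acting on A (x) B, basis index 2*a + b *)
definition kron2 :: "complex mat \<Rightarrow> complex mat \<Rightarrow> complex mat" where
  "kron2 M N = mat 4 4 (\<lambda>(i, j). M $$ (i div 2, j div 2) * N $$ (i mod 2, j mod 2))"

definition Ugate :: "real \<Rightarrow> complex mat" where
  "Ugate x =
     (complex_of_real ((cos x)^3) + \<i> * complex_of_real ((sin x)^3)) \<cdot>\<^sub>m kron2 (pauli 0) (pauli 0)
   + (\<i> * complex_of_real (sin x * cos x) * exp (- \<i> * complex_of_real x)) \<cdot>\<^sub>m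
       (kron2 (pauli 1) (pauli 1) + kron2 (pauli 2) (pauli 2) + kron2 (pauli 3) (pauli 3))"

definition unit_state :: "nat \<Rightarrow> complex vec \<Rightarrow> bool" where
  "unit_state d v \<longleftrightarrow> v \<in> carrier_vec d \<and> (\<Sum>i<d. (cmod (v $ i))^2) = 1"

(* Input |phi>_{A R_A} in C^2 (x) C^dRA, basis index a*dRA + r;
   input |psi>_{B R_B} in C^2 (x) C^dRB, basis index b*dRB + s.
   Amplitude of U(|phi> (x) |psi>) at |a r b s>, U acting on A,B (U basis index 2*a + b). *)
definition out_amp ::
  "complex mat \<Rightarrow> nat \<Rightarrow> nat \<Rightarrow> complex vec \<Rightarrow> complex vec \<Rightarrow> nat \<Rightarrow> nat \<Rightarrow> nat \<Rightarrow> nat \<Rightarrow> complex" where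
  "out_amp U dRA dRB phi psi a r b s =
     (\<Sum>a'<2. \<Sum>b'<2. U $$ (2 * a + b, 2 * a' + b') * phi $ (a' * dRA + r) * psi $ (b' * dRB + s))"

(* reduced state Tr_{A R_A} of U(|phi> (x) |psi>), a matrix on B R_B (index b*dRB + s) *)
definition reduced_BR ::
  "complex mat \<Rightarrow> nat \<Rightarrow> nat \<Rightarrow> complex vec \<Rightarrow> complex vec \<Rightarrow> complex mat" where
  "reduced_BR U dRA dRB phi psi =
     mat (2 * dRB) (2 * dRB) (\<lambda>(i, j).
       \<Sum>a<2. \<Sum>r<dRA. out_amp U dRA dRB phi psi a r (i div dRB) (i mod dRB)
                       * cnj (out_amp U dRA dRB phi psi a r (j div dRB) (j mod dRB)))"

definition ent_out :: "complex mat \<Rightarrow> nat \<Rightarrow> nat \<Rightarrow> complex vec \<Rightarrow> complex vec \<Rightarrow> real" where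
  "ent_out U dRA dRB phi psi = vn_entropy (reduced_BR U dRA dRB phi psi)"

definition entangling_power :: "complex mat \<Rightarrow> real" where
  "entangling_power U = Sup {ent_out U dRA dRB phi psi | dRA dRB phi psi.
       dRA \<ge> 1 \<and> dRB \<ge> 1 \<and> unit_state (2 * dRA) phi \<and> unit_state (2 * dRB) psi}"

(* |00>_{A R_A} (dRA = 2) and |11>_{B R_B} (dRB = 2) *)
definition ket00 :: "complex vec" where "ket00 = unit_vec 4 0"
definition ket11 :: "complex vec" where "ket11 = unit_vec 4 3"
(* (|00> + |11>)/sqrt 2 with a 2-dimensional ancilla *)
definition bell :: "complex vec" where
  "bell = vec 4 (\<lambda>i. if i = 0 \<or> i = 3 then complex_of_real (1 / sqrt 2) else 0)"

end

theory Submission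
  imports Defs "HOL-Analysis.Convex" "HOL-Real_Asymp.Real_Asymp"
    "Jordan_Normal_Form.Schur_Decomposition"
begin

text \<open>
  Up to a phase the gate is \<open>cos \<theta> \<cdot> 1 + \<i> sin \<theta> \<cdot> SWAP\<close> with \<open>\<theta> = 2x\<close>, so it commutes with every
  \<open>V \<otimes> V\<close>, and the reduced input state of \<open>B\<close> may be taken diagonal. Relative to the Schmidt basis
  of the input on \<open>B R\<^sub>B\<close>, the output splits into a sector where \<open>B\<close> is unchanged and one where it
  is flipped. Discarding the coherences between the two can only increase the entropy, and there are
  none if the reduced input state of \<open>A\<close> is diagonal as well. With \<open>p\<close>, \<open>q\<close> the populations of
  \<open>A\<close> and \<open>B\<close>, \<open>u = p (1 - q)\<close>, \<open>v = (1 - p) q\<close> and \<open>4a = sin\<^sup>2 \<theta>\<close>, what remains is the spectrum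
  \<open>4au, 4av, l, m\<close> with \<open>l + m = 1 - 4a (u + v)\<close> and \<open>l m = 16a (1 - 3a) u v\<close>.

  For fixed \<open>u + v\<close> the entropy grows with \<open>u v\<close>. If \<open>u + v \<le> 1/2\<close>, the Gibbs inequality against
  \<open>(a, a, a, 1 - 3a)\<close> bounds it by the value \<open>H\<^sub>2\<close> of the Bell input. Otherwise one is on the path of
  antipodal Bloch vectors of length \<open>\<surd>y\<close>, which joins the Bell input (\<open>y = 0\<close>) to the product input
  (\<open>y = 1\<close>, value \<open>H\<^sub>1\<close>): there the entropy is at most \<open>H\<^sub>2\<close> if \<open>a \<ge> 1/16\<close> and lies below the chord
  \<open>y H\<^sub>1 + (1 - y) H\<^sub>2\<close> if \<open>a \<le> 1/16\<close>. Finally \<open>(H\<^sub>2 - H\<^sub>1) / a\<close> is increasing in \<open>a\<close>, so the two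
  values cross exactly once.
\<close>

section \<open>Entropy inequalities\<close>

definition eta_ln :: "real \<Rightarrow> real" where
  "eta_ln t = - t * ln t"

lemma eta_eq_eta_ln: "0 \<le> t \<Longrightarrow> eta t = eta_ln t / ln 2"
  by (auto simp: eta_def eta_ln_def log_def)

lemma eta_ln_0 [simp]: "eta_ln 0 = 0"
  by (simp add: eta_ln_def)

lemma eta_ln_le_tangent:
  assumes "0 \<le> t" "0 < z"
  shows "eta_ln t \<le> - t * ln z + (z - t)"
proof (cases "t = 0")
  case False
  then have "ln (z / t) \<le> z / t - 1"
    using assms by (intro ln_le_minus_one) auto
  then have "t * (ln z - ln t) \<le> t * (z / t - 1)"
    using assms False by (intro mult_left_mono) (auto simp: ln_div)
  then show ?thesis
    using False by (simp add: eta_ln_def algebra_simps)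
qed (use assms in simp)

lemma concave_on_eta_ln: "concave_on {0..} eta_ln"
proof
  fix t x y :: real
  assume t: "0 < t" "t < 1" and x: "x \<in> {0..}" and "y \<in> {0..}" and "x < y"
  define z where "z = (1 - t) * x + t * y"
  have "0 < z"
    using t x \<open>x < y\<close> by (simp add: z_def add_nonneg_pos)
  then have "(1 - t) * eta_ln x + t * eta_ln y
      \<le> (1 - t) * (- x * ln z + (z - x)) + t * (- y * ln z + (z - y))"
    using t x \<open>x < y\<close> by (intro add_mono mult_left_mono eta_ln_le_tangent) auto
  also have "\<dots> = - z * ln z"
    by (simp add: z_def algebra_simps)
  finally show "(1 - t) * eta_ln x + t * eta_ln y \<le> eta_ln ((1 - t) *\<^sub>R x + t *\<^sub>R y)"
    by (simp add: z_def eta_ln_def)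
qed simp

lemma concave_on_eta: "concave_on {0..} eta"
proof -
  have "concave_on {0..} (\<lambda>t. eta_ln t / ln 2)"
    by (intro concave_on_cdiv concave_on_eta_ln) simp
  then show ?thesis
    by (simp add: concave_on_iff eta_eq_eta_ln)
qed

lemma concave_on_add_le:
  fixes f :: "real \<Rightarrow> real"
  assumes f: "concave_on S f" and xy: "x \<in> S" "y \<in> S"
    and x': "x \<le> x'" "x' \<le> y" and eq: "x + y = x' + y'"
  shows "f x + f y \<le> f x' + f y'"
proof (cases "x = y")
  case True
  with x' have "x' = x" by simp
  with True eq show ?thesis by simp
next
  case False
  with x' have "x < y" by simp
  define t where "t = (x' - x) / (y - x)"
  have t: "0 \<le> t" "t \<le> 1" using x' \<open>x < y\<close> by (auto simp: t_def)
  have "t * (y - x) = x' - x" using \<open>x < y\<close> by (simp add: t_def)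
  then have "x' = (1 - t) * x + t * y" "y' = t * x + (1 - t) * y"
    using eq by (simp_all add: algebra_simps)
  then have "(1 - t) * f x + t * f y \<le> f x'" "t * f x + (1 - t) * f y \<le> f y'"
    using concave_onD[OF f, of t x y] concave_onD[OF f, of "1 - t" x y] t xy by simp_all
  then show ?thesis by (simp add: algebra_simps)
qed

lemma eta_ln_add_mono_product:
  assumes nonneg: "0 \<le> x" "0 \<le> y"
    and eq_sum: "x + y = x' + y'" and le_prod: "x * y \<le> x' * y'"
  shows "eta_ln x + eta_ln y \<le> eta_ln x' + eta_ln y'"
  using nonneg eq_sum le_prod
proof (induction x y rule: linorder_wlog)
  case (le x y)
  have "y' = x + y - x'" using le.prems by simp
  with le.prems have "(x' - x) * (x' - y) \<le> 0" by (simp add: algebra_simps)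
  then have "x \<le> x'" "x' \<le> y" using le.hyps by (auto simp: mult_le_0_iff)
  with le.prems show ?case
    by (intro concave_on_add_le[OF concave_on_eta_ln]) auto
next
  case (sym x y)
  then show ?case by (simp add: add.commute mult.commute)
qed

lemma two_mult_le_ln_diff:
  assumes "0 \<le> z" "z < (1::real)"
  shows "2 * z \<le> ln (1 + z) - ln (1 - z)"
proof -
  let ?g = "\<lambda>z::real. ln (1 + z) - ln (1 - z) - 2 * z"
  have "?g 0 \<le> ?g z"
  proof (rule DERIV_nonneg_imp_nondecreasing[OF assms(1)], intro exI conjI)
    fix w assume "0 \<le> w" "w \<le> z"
    then have w: "0 \<le> w" "w < 1" using assms by auto
    then show "(?g has_real_derivative (1 / (1 + w) + 1 / (1 - w) - 2)) (at w)"
      by (auto intro!: derivative_eq_intros)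
    have "1 - w \<le> 1 / (1 + w)" "1 + w \<le> 1 / (1 - w)"
      using w by (subst pos_le_divide_eq; simp add: algebra_simps)+
    then show "0 \<le> 1 / (1 + w) + 1 / (1 - w) - 2" by simp
  qed
  then show ?thesis by simp
qed

lemma binary_pinsker:
  assumes "0 \<le> k" "k < (1::real)"
  shows "k^2 \<le> (1 + k) * ln (1 + k) + (1 - k) * ln (1 - k)"
proof -
  let ?f = "\<lambda>k::real. (1 + k) * ln (1 + k) + (1 - k) * ln (1 - k) - k^2"
  have "?f 0 \<le> ?f k"
  proof (rule DERIV_nonneg_imp_nondecreasing[OF assms(1)], intro exI conjI)
    fix z assume "0 \<le> z" "z \<le> k"
    then have z: "0 \<le> z" "z < 1" using assms by auto
    then show "(?f has_real_derivative (ln (1 + z) - ln (1 - z) - 2 * z)) (at z)"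
      by (auto intro!: derivative_eq_intros)
    show "0 \<le> ln (1 + z) - ln (1 - z) - 2 * z"
      using two_mult_le_ln_diff[OF z] by simp
  qed
  then show ?thesis by simp
qed

lemma square_weighted_ln_ratio_antimono:
  fixes k l :: real
  defines "G \<equiv> \<lambda>k. (1 + k)^2 * ln (1 + k) + (1 - k)^2 * ln (1 - k)"
  assumes "0 < k" "k \<le> l" "l < 1"
  shows "G l / l^2 \<le> G k / k^2"
proof (rule DERIV_nonpos_imp_nonincreasing[OF assms(3)], intro exI conjI)
  fix z assume "k \<le> z" "z \<le> l"
  then have z: "0 < z" "z < 1" using assms by auto
  define G' where "G' = 2 * (1 + z) * ln (1 + z) + (1 + z) - 2 * (1 - z) * ln (1 - z) - (1 - z)"
  have "(G has_real_derivative G') (at z)"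
    unfolding G_def G'_def using z
    by (auto intro!: derivative_eq_intros simp: power2_eq_square) (simp add: field_simps)
  then show "((\<lambda>l. G l / l^2) has_real_derivative (G' * z^2 - G z * (2 * z)) / (z^2 * z^2)) (at z)"
    using z by (intro DERIV_divide) (auto intro!: derivative_eq_intros)
  have "G' * z^2 - G z * (2 * z) = 2 * z * (z^2 - ((1 + z) * ln (1 + z) + (1 - z) * ln (1 - z)))"
    by (simp add: G_def G'_def algebra_simps power2_eq_square)
  also have "\<dots> \<le> 0"
    using binary_pinsker[of z] z by (simp add: mult_le_0_iff)
  finally show "(G' * z^2 - G z * (2 * z)) / (z^2 * z^2) \<le> 0"
    by (simp add: divide_nonpos_nonneg)
qed

lemma square_weighted_ln_ge:
  assumes "0 \<le> k" "k \<le> (1::real)"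
  shows "4 * ln 2 * k^2 \<le> (1 + k)^2 * ln (1 + k) + (1 - k)^2 * ln (1 - k)"
proof -
  let ?G = "\<lambda>k::real. (1 + k)^2 * ln (1 + k) + (1 - k)^2 * ln (1 - k)"
  consider "k = 0" | "k = 1" | "0 < k" "k < 1" using assms by linarith
  then show ?thesis
  proof cases
    case 3
    have "((\<lambda>l::real. ?G l / l^2) \<longlongrightarrow> 4 * ln 2) (at_left 1)"
      by real_asymp
    moreover have "\<forall>\<^sub>F l in at_left 1. ?G l / l^2 \<le> ?G k / k^2"
      using eventually_at_left_real[OF \<open>k < 1\<close>]
      by eventually_elim (use 3 in \<open>auto intro: square_weighted_ln_ratio_antimono\<close>)
    ultimately have "4 * ln 2 \<le> ?G k / k^2"
      by (intro tendsto_upperbound) auto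
    then show ?thesis using 3 by (simp add: pos_le_divide_eq)
  qed auto
qed

lemma ln_16: "ln (16::real) = 4 * ln 2"
  using ln_realpow[of 2 4] by simp

lemma ln_2_ge: "7/12 \<le> ln (2::real)"
proof -
  have "ln (2::real) = ln (4/3) + ln (3/2)"
    using ln_mult[of "4/3::real" "3/2"] by simp
  moreover have "- ln (4/3) = ln (3/4::real)" "- ln (3/2) = ln (2/3::real)"
    by (simp_all add: ln_div)
  moreover have "ln (3/4::real) \<le> 3/4 - 1" "ln (2/3::real) \<le> 2/3 - 1"
    by (rule ln_le_minus_one; simp)+
  ultimately show ?thesis by simp
qed

definition product_entropy :: "real \<Rightarrow> real" where
  "product_entropy a = eta_ln (4 * a) + eta_ln (1 - 4 * a)"

definition bell_entropy :: "real \<Rightarrow> real" where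
  "bell_entropy a = 3 * eta_ln a + eta_ln (1 - 3 * a)"

lemma ln_4_mult: "0 < a \<Longrightarrow> ln (4 * a) = 2 * ln 2 + ln (a::real)"
  using ln_realpow[of 2 2] by (simp add: ln_mult)

lemma entropy_gap_ratio_mono:
  assumes "0 < a" "a \<le> b" "b < 1/4"
  shows "(bell_entropy a - product_entropy a) / a \<le> (bell_entropy b - product_entropy b) / b"
proof (rule DERIV_nonneg_imp_nondecreasing[OF assms(2)], intro exI conjI)
  define W where "W z = bell_entropy z - product_entropy z" for z
  fix z assume "a \<le> z" "z \<le> b"
  then have z: "0 < z" "z < 1/4" using assms by auto
  define W' where "W' = ln z + 8 * ln 2 + 3 * ln (1 - 3 * z) - 4 * ln (1 - 4 * z)"
  have "(16 * z - 4) / (1 - 4 * z) = - 4" "(9 * z - 3) / (1 - 3 * z) = - 3"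
    using z by (simp_all add: divide_eq_eq)
  then have "(W has_real_derivative W') (at z)"
    unfolding W_def W'_def bell_entropy_def product_entropy_def eta_ln_def using z
    by (auto intro!: derivative_eq_intros simp: ln_4_mult)
  then show "((\<lambda>a. (bell_entropy a - product_entropy a) / a)
      has_real_derivative (W' * z - W z * 1) / (z * z)) (at z)"
    unfolding W_def using z by (intro DERIV_divide) (auto intro!: derivative_eq_intros)
  have "W' * z - W z * 1 = ln (1 - 3 * z) - ln (1 - 4 * z)"
    unfolding W_def W'_def bell_entropy_def product_entropy_def eta_ln_def ln_4_mult[OF z(1)]
    by (simp add: algebra_simps)
  also have "\<dots> \<ge> 0" using z by simp
  finally show "0 \<le> (W' * z - W z * 1) / (z * z)" using z by simp
qed

lemma bell_entropy_le_product_entropy: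
  assumes "bell_entropy a0 = product_entropy a0" "a0 < 1/4" "0 < a" "a \<le> a0"
  shows "bell_entropy a \<le> product_entropy a"
proof -
  have "(bell_entropy a - product_entropy a) / a \<le> 0"
    using entropy_gap_ratio_mono[of a a0] assms by simp
  then show ?thesis using \<open>0 < a\<close> by (simp add: divide_le_0_iff)
qed

lemma product_entropy_le_bell_entropy:
  assumes "bell_entropy a0 = product_entropy a0" "0 < a0" "a0 \<le> a" "a \<le> 1/4"
  shows "product_entropy a \<le> bell_entropy a"
proof (cases "a = 1/4")
  case True
  show ?thesis
    unfolding True by (simp add: product_entropy_def bell_entropy_def eta_ln_def ln_div)
next
  case False
  then have "0 \<le> (bell_entropy a - product_entropy a) / a"
    using entropy_gap_ratio_mono[of a0 a] assms by simp
  then show ?thesis using assms by (simp add: zero_le_divide_iff)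
qed

lemma antipodal_pair_entropy_le:
  fixes a y :: real
  assumes a_range: "0 < a" and y_range: "0 \<le> y" "y \<le> 1"
  shows "eta_ln (a * (1 + sqrt y)^2) + eta_ln (a * (1 - sqrt y)^2)
    \<le> - (2 * a + 2 * a * y) * ln a - 8 * a * ln 2 * y"
proof -
  define k where "k = sqrt y"
  have k_range: "0 \<le> k" "k \<le> 1" "k^2 = y" using y_range by (auto simp: k_def)
  have eta_ln_scaled: "eta_ln (a * z^2) = - (a * z^2) * ln a - 2 * a * (z^2 * ln z)"
    if "0 \<le> z" for z
    using that a_range by (cases "z = 0") (auto simp: eta_ln_def ln_mult ln_realpow algebra_simps)
  have "eta_ln (a * (1 + k)^2) + eta_ln (a * (1 - k)^2)
      = - (2 * a + 2 * a * k^2) * ln a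
        - 2 * a * ((1 + k)^2 * ln (1 + k) + (1 - k)^2 * ln (1 - k))"
    using k_range by (subst (1 2) eta_ln_scaled) (auto simp: power2_eq_square algebra_simps)
  also have "\<dots> \<le> - (2 * a + 2 * a * k^2) * ln a - 2 * a * (4 * ln 2 * k^2)"
    using square_weighted_ln_ge[OF k_range(1,2)] a_range
    by (intro diff_left_mono mult_left_mono) auto
  finally show ?thesis
    unfolding k_range(3) by (simp add: k_def algebra_simps)
qed

text \<open>
  The largest eigenvalue \<open>l\<close> is compared with its value \<open>1 - 3a\<close> at \<open>y = 0\<close>; the deficit \<open>d\<close>
  satisfies \<open>a y\<^sup>2 \<le> d \<le> a y\<close>, and the gap \<open>a y - d\<close>, weighted by \<open>- ln a\<close>, is what pays for all
  error terms when \<open>a \<le> 1/16\<close>.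
\<close>

locale antipodal_spectrum =
  fixes a y l m d :: real
  assumes a_range: "0 < a" "a \<le> 1/4" and y_range: "0 \<le> y" "y \<le> 1" and m_range: "0 \<le> m" "m \<le> l"
    and l_eq: "l = 1 - 3 * a - d" and m_eq: "m = a - 2 * a * y + d"
    and prod_eq: "l * m = (1 - y)^2 * a * (1 - 3 * a)"
begin

definition total_entropy :: real where
  "total_entropy = eta_ln (a * (1 + sqrt y)^2) + eta_ln (a * (1 - sqrt y)^2) + eta_ln l + eta_ln m"

lemma sum_eq: "l + m = 1 - 2 * a - 2 * a * y"
  by (simp add: l_eq m_eq)

lemma l_nonneg: "0 \<le> l"
  using m_range by simp

lemma one_minus_3a_pos: "0 < 1 - 3 * a"
  using a_range by simp

lemma ay_bounds: "0 \<le> a * y" "a * y \<le> a"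
  using a_range y_range by (auto simp: mult_left_le)

lemma characteristic_eq:
  "(\<mu> - l) * (\<mu> - m) = \<mu>^2 - (1 - 2 * a - 2 * a * y) * \<mu> + (1 - y)^2 * a * (1 - 3 * a)"
proof -
  have "(\<mu> - l) * (\<mu> - m) = \<mu>^2 - (l + m) * \<mu> + l * m"
    by (simp add: power2_eq_square algebra_simps)
  then show ?thesis unfolding sum_eq prod_eq .
qed

lemma deficit_le: "d \<le> a * y"
proof -
  define \<mu> where "\<mu> = 1 - 3 * a - a * y"
  have "(\<mu> - l) * (\<mu> - m) = - (a * (1 - y) * y * (1 - 4 * a))"
    unfolding characteristic_eq \<mu>_def by (simp add: power2_eq_square algebra_simps)
  also have "\<dots> \<le> 0" using a_range y_range by simp
  finally have "\<not> (0 < \<mu> - l \<and> 0 < \<mu> - m)" by (metis mult_pos_pos not_le)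
  then show ?thesis using m_range by (auto simp: \<mu>_def l_eq)
qed

lemma total_entropy_le_bell_entropy:
  assumes "1/16 \<le> a"
  shows "total_entropy \<le> bell_entropy a"
proof -
  define r where "r = ln (1 - 3 * a) - ln a"
  have "r = ln ((1 - 3 * a) / a)"
    using a_range one_minus_3a_pos by (simp add: r_def ln_div)
  also have "\<dots> \<le> ln 16"
    using assms a_range one_minus_3a_pos by (subst ln_le_cancel_iff) (auto simp: field_simps)
  finally have r_range: "0 \<le> r" "r \<le> 8 * ln 2 - 2"
    using a_range one_minus_3a_pos ln_2_ge by (auto simp: r_def ln_16)
  have "d * r \<le> a * y * r"
    using deficit_le r_range by (intro mult_right_mono)
  also have "\<dots> \<le> a * y * (8 * ln 2 - 2)"
    using ay_bounds r_range by (intro mult_left_mono)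
  finally have deficit_cost: "d * r \<le> a * y * (8 * ln 2 - 2)" .
  have "eta_ln l \<le> - l * ln (1 - 3 * a) + (1 - 3 * a - l)" "eta_ln m \<le> - m * ln a + (a - m)"
    by (intro eta_ln_le_tangent l_nonneg one_minus_3a_pos a_range m_range)+
  then have "total_entropy \<le> bell_entropy a + (d * r - a * y * (8 * ln 2 - 2))"
    using antipodal_pair_entropy_le[OF a_range(1) y_range]
    unfolding total_entropy_def bell_entropy_def eta_ln_def[of a] eta_ln_def[of "1 - 3 * a"] r_def
    unfolding l_eq m_eq by (simp add: algebra_simps)
  with deficit_cost show ?thesis by linarith
qed

context
  assumes a_le: "a \<le> 1/16"
begin

lemma l_ge: "1 - 4 * a \<le> l" "3/4 \<le> l"
  using deficit_le ay_bounds a_le by (simp_all add: l_eq)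

lemma deficit_ge: "a * y^2 \<le> d"
proof -
  define \<mu> where "\<mu> = 1 - 3 * a - a * y^2"
  have "(\<mu> - l) * (\<mu> - m) = (a * y * (1 - y))^2"
    unfolding characteristic_eq \<mu>_def by (simp add: power2_eq_square algebra_simps)
  then have "0 \<le> (\<mu> - l) * (\<mu> - m)" by simp
  moreover have "a * y^2 \<le> a * 1"
    using a_range y_range by (intro mult_left_mono) (auto simp: power_le_one)
  then have "0 < \<mu> - m"
    using sum_eq l_ge ay_bounds a_le a_range unfolding \<mu>_def by linarith
  ultimately show ?thesis by (auto simp: \<mu>_def l_eq zero_le_mult_iff)
qed

lemma deficit_nonneg: "0 \<le> d"
  using order_trans[OF _ deficit_ge, of 0] a_range by simp

definition shrinkage :: real where
  "shrinkage = (1 - 3 * a) / l"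

lemma shrinkage_bounds: "1 \<le> shrinkage" "shrinkage \<le> 1 + y / 12" "shrinkage \<le> 13/12"
proof -
  show "1 \<le> shrinkage"
    unfolding shrinkage_def using l_ge deficit_nonneg by (simp add: l_eq)
  have "shrinkage - 1 = d / l"
    using l_ge l_eq by (simp add: shrinkage_def field_simps)
  also have "\<dots> \<le> (a * y) / l"
    using deficit_le l_ge by (intro divide_right_mono) auto
  also have "\<dots> \<le> (1/16 * y) / (3/4)"
    using l_ge ay_bounds a_le y_range by (intro frac_le mult_right_mono) auto
  finally show "shrinkage \<le> 1 + y / 12" by simp
  with y_range show "shrinkage \<le> 13/12" by simp
qed

lemma m_eq_shrinkage: "m = a * (1 - y)^2 * shrinkage"
  using prod_eq l_ge by (simp add: shrinkage_def field_simps)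

lemma eta_ln_m_le: "eta_ln m \<le> - m * ln a + 13/6 * (a * (1 - y) * y)"
proof (cases "y = 1")
  case True
  then show ?thesis by (simp add: m_eq_shrinkage)
next
  case False
  define e where "e = 1 - y"
  have e: "0 < e" using y_range False by (simp add: e_def)
  have "ln m = ln a + 2 * ln e + ln shrinkage"
    using e a_range shrinkage_bounds by (simp add: m_eq_shrinkage e_def ln_mult ln_realpow)
  then have "eta_ln m = - m * ln a + 2 * a * e * shrinkage * eta_ln e - m * ln shrinkage"
    by (simp add: eta_ln_def m_eq_shrinkage flip: e_def) (simp add: power2_eq_square algebra_simps)
  also have "\<dots> \<le> - m * ln a + 2 * a * e * shrinkage * eta_ln e"
    using m_range shrinkage_bounds by simp
  also have "\<dots> \<le> - m * ln a + 2 * a * e * shrinkage * y"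
    using eta_ln_le_tangent[of e 1] a_range e shrinkage_bounds
    by (intro add_left_mono mult_left_mono) (auto simp: e_def)
  also have "2 * a * e * shrinkage * y = (2 * shrinkage) * (a * e * y)" by simp
  also have "\<dots> \<le> 13/6 * (a * e * y)"
    using shrinkage_bounds a_range e y_range by (intro mult_right_mono) auto
  finally show ?thesis by (simp add: e_def)
qed

lemma eta_ln_l_le:
  "eta_ln l \<le> y * eta_ln (1 - 4 * a) + (1 - y) * eta_ln (1 - 3 * a)
    + 2/3 * (a * (1 - y) * y) - (a * y - d)"
proof -
  have pos: "0 < 1 - 4 * a" using a_le by simp
  have "eta_ln l = y * eta_ln l + (1 - y) * eta_ln l" by (simp add: algebra_simps)
  also have "\<dots> \<le> y * (- l * ln (1 - 4 * a) + (1 - 4 * a - l))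
      + (1 - y) * (- l * ln (1 - 3 * a) + (1 - 3 * a - l))"
    using y_range l_nonneg one_minus_3a_pos pos
    by (intro add_mono mult_left_mono eta_ln_le_tangent) auto
  also have "\<dots> = y * eta_ln (1 - 4 * a) + (1 - y) * eta_ln (1 - 3 * a)
      + (a - d) * y * (- ln (1 - 4 * a)) + (1 - y) * d * ln (1 - 3 * a) - (a * y - d)"
    by (simp add: eta_ln_def l_eq algebra_simps)
  also have "(1 - y) * d * ln (1 - 3 * a) \<le> 0"
    using y_range deficit_nonneg a_range one_minus_3a_pos by (intro mult_nonneg_nonpos) auto
  also have "(a - d) * y * (- ln (1 - 4 * a)) \<le> (2 * (a * (1 - y))) * y * (1/3)"
  proof (intro mult_mono)
    have "a - d \<le> a * (1 - y^2)" using deficit_ge by (simp add: algebra_simps)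
    also have "1 - y^2 = (1 - y) * (1 + y)" by (simp add: power2_eq_square algebra_simps)
    also have "a * ((1 - y) * (1 + y)) \<le> a * ((1 - y) * 2)"
      using a_range y_range by (intro mult_left_mono) auto
    finally show "a - d \<le> 2 * (a * (1 - y))" by (simp add: algebra_simps)
    have "- ln (1 - 4 * a) = ln (1 / (1 - 4 * a))" using pos by (simp add: ln_div)
    also have "\<dots> \<le> 1 / (1 - 4 * a) - 1" using pos by (intro ln_le_minus_one) auto
    also have "\<dots> \<le> 1/3" using a_le by (simp add: field_simps)
    finally show "- ln (1 - 4 * a) \<le> 1/3" .
  qed (use a_range y_range pos in auto)
  finally show ?thesis by simp
qed

lemma deficit_gap_ge: "11/12 * (a * (1 - y) * y) \<le> a * y - d"
proof -
  have "(shrinkage - 1) * (1 - y) \<le> (y / 12) * 1"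
    using shrinkage_bounds y_range by (intro mult_mono) auto
  then have "a * (1 - y) * (y - y / 12) \<le> a * (1 - y) * (y - (shrinkage - 1) * (1 - y))"
    using a_range y_range by (intro mult_left_mono diff_left_mono) auto
  also have "\<dots> = a * (1 - y) - m"
    by (simp add: m_eq_shrinkage power2_eq_square algebra_simps)
  finally show ?thesis by (simp add: m_eq algebra_simps)
qed

lemma total_entropy_le_chord:
  "total_entropy \<le> y * product_entropy a + (1 - y) * bell_entropy a"
proof -
  define E where "E = a * (1 - y) * y"
  have nonneg: "0 \<le> E" using a_range y_range by (simp add: E_def)
  have "ln a \<le> ln (1/16)" using a_range a_le by (subst ln_le_cancel_iff) auto
  then have ln_a: "7/3 \<le> - ln a" using ln_2_ge by (simp add: ln_div ln_16)
  have "17/6 * E \<le> 11/12 * E * (10/3)" using nonneg by simp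
  also have "\<dots> \<le> (a * y - d) * (1 - ln a)"
    using deficit_gap_ge ln_a nonneg by (intro mult_mono) (auto simp: E_def)
  finally have errors_paid: "17/6 * E \<le> (a * y - d) * (1 - ln a)" .
  have "y * eta_ln (4 * a) + (1 - y) * (3 * eta_ln a) = - (3 * a + a * y) * ln a - 8 * a * ln 2 * y"
    unfolding eta_ln_def ln_4_mult[OF a_range(1)] by (simp add: algebra_simps)
  moreover have "- m * ln a = - (a - a * y) * ln a + (a * y - d) * ln a"
    by (simp add: m_eq algebra_simps)
  ultimately show ?thesis
    using antipodal_pair_entropy_le[OF a_range(1) y_range] eta_ln_m_le[folded E_def]
      eta_ln_l_le[folded E_def] errors_paid
    unfolding total_entropy_def product_entropy_def bell_entropy_def
    by (simp add: algebra_simps)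
qed

end

lemma total_entropy_le_max: "total_entropy \<le> max (product_entropy a) (bell_entropy a)"
proof (cases "1/16 \<le> a")
  case True
  then show ?thesis using total_entropy_le_bell_entropy by simp
next
  case False
  then have "total_entropy \<le> y * product_entropy a + (1 - y) * bell_entropy a"
    by (intro total_entropy_le_chord) simp
  also have "\<dots> \<le> max (product_entropy a) (bell_entropy a)"
    using y_range by (intro convex_bound_le) auto
  finally show ?thesis .
qed

end

lemma nonneg_pair_with_sum_prod:
  fixes t d :: real
  assumes "0 \<le> t" "0 \<le> d" "4 * d \<le> t^2"
  obtains l m where "0 \<le> m" "m \<le> l" "l + m = t" "l * m = d"
proof
  define r where "r = sqrt (t^2 - 4 * d)"
  have r_range: "0 \<le> r" "r^2 = t^2 - 4 * d" using assms by (auto simp: r_def)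
  show "0 \<le> (t - r) / 2"
    using assms by (auto simp: r_def intro: real_le_lsqrt)
  show "(t - r) / 2 \<le> (t + r) / 2" using r_range by simp
  show "(t + r) / 2 + (t - r) / 2 = t" by (simp add: field_simps)
  have "(t + r) / 2 * ((t - r) / 2) = (t^2 - r^2) / 4"
    by (simp add: power2_eq_square algebra_simps)
  then show "(t + r) / 2 * ((t - r) / 2) = d" using r_range by simp
qed

lemma dominant_ge_of_sum_ge_prod_le:
  fixes b c l m :: real
  assumes "c \<le> b" "m \<le> l" "0 \<le> l" and sum_ge: "b + c \<le> l + m" and prod_le: "l * m \<le> b * c"
  shows "b \<le> l"
proof (rule ccontr)
  assume "\<not> b \<le> l"
  have "(b + c) * l \<le> (l + m) * l" using sum_ge \<open>0 \<le> l\<close> by (rule mult_right_mono)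
  then have "0 \<le> (l - b) * (l - c)" using prod_le by (simp add: algebra_simps)
  with \<open>\<not> b \<le> l\<close> have "l \<le> c" by (simp add: zero_le_mult_iff)
  with \<open>\<not> b \<le> l\<close> assms show False by linarith
qed

text \<open>Gibbs' inequality against the Bell spectrum \<open>(a, a, a, 1 - 3a)\<close>.\<close>

lemma sector_entropy_le_bell_entropy:
  fixes a u v l m :: real
  assumes a_range: "0 < a" "a \<le> 1/4" and uv_range: "0 \<le> u" "0 \<le> v" "u + v \<le> 1/2"
    and m_range: "0 \<le> m" "m \<le> l"
    and sum_eq: "l + m = 1 - 4 * a * (u + v)" and prod_eq: "l * m = 16 * a * (1 - 3 * a) * (u * v)"
  shows "eta_ln (4 * a * u) + eta_ln (4 * a * v) + eta_ln l + eta_ln m \<le> bell_entropy a"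
proof -
  have pos: "0 < 1 - 3 * a" using a_range by simp
  have "1 - 3 * a \<le> l"
  proof (rule dominant_ge_of_sum_ge_prod_le)
    have "a * (u + v) \<le> a * (1/2)" using uv_range a_range by (intro mult_left_mono) auto
    then show "1 - 3 * a + a \<le> l + m" using sum_eq by simp
    have "4 * (u * v) \<le> (u + v)^2"
      using zero_le_power2[of "u - v"] by (simp add: power2_eq_square algebra_simps)
    also have "\<dots> \<le> (1/2)^2" using uv_range by (intro power_mono) auto
    finally have "4 * a * (1 - 3 * a) * (4 * (u * v)) \<le> 4 * a * (1 - 3 * a) * (1/4)"
      using a_range pos by (intro mult_left_mono) (auto simp: power2_eq_square)
    then show "l * m \<le> (1 - 3 * a) * a" using prod_eq by (simp add: algebra_simps)
  qed (use a_range m_range in auto)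
  then have "(1 - 3 * a - l) * (ln (1 - 3 * a) - ln a) \<le> 0"
    using a_range pos by (intro mult_nonpos_nonneg) auto
  moreover have "eta_ln (4 * a * u) \<le> - (4 * a * u) * ln a + (a - 4 * a * u)"
    "eta_ln (4 * a * v) \<le> - (4 * a * v) * ln a + (a - 4 * a * v)"
    "eta_ln m \<le> - m * ln a + (a - m)"
    "eta_ln l \<le> - l * ln (1 - 3 * a) + (1 - 3 * a - l)"
    by (rule eta_ln_le_tangent; use a_range pos uv_range m_range in simp)+
  moreover have m_eq: "m = 1 - 4 * a * u - 4 * a * v - l"
    using sum_eq by (simp add: algebra_simps)
  have "m * ln a = ln a - 4 * a * u * ln a - 4 * a * v * ln a - l * ln a"
    unfolding m_eq by (simp add: algebra_simps)
  moreover have "m + 4 * a * u + 4 * a * v + l = 1"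
    using m_eq by simp
  ultimately show ?thesis
    unfolding bell_entropy_def eta_ln_def[of a] eta_ln_def[of "1 - 3 * a"]
    by (simp add: algebra_simps)
qed

lemma eta_ln_pair_le_antipodal:
  fixes a u v y :: real
  assumes a_range: "0 \<le> a" and y_range: "0 \<le> y" and uv_range: "0 \<le> u" "0 \<le> v"
    and uv_sum: "u + v = (1 + y) / 2" and uv_prod: "16 * (u * v) \<le> (1 - y)^2"
  shows "eta_ln (4 * a * u) + eta_ln (4 * a * v)
    \<le> eta_ln (a * (1 + sqrt y)^2) + eta_ln (a * (1 - sqrt y)^2)"
proof (rule eta_ln_add_mono_product)
  have sqrt_y: "(sqrt y)^2 = y" using y_range by simp
  have "4 * a * u + 4 * a * v = 4 * a * (u + v)" by (simp add: algebra_simps)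
  also have "\<dots> = 2 * a * (1 + (sqrt y)^2)" unfolding uv_sum sqrt_y by simp
  also have "\<dots> = a * (1 + sqrt y)^2 + a * (1 - sqrt y)^2"
    by (simp add: power2_eq_square algebra_simps)
  finally show "4 * a * u + 4 * a * v = a * (1 + sqrt y)^2 + a * (1 - sqrt y)^2" .
  have "4 * a * u * (4 * a * v) = a^2 * (16 * (u * v))" by (simp add: power2_eq_square)
  also have "\<dots> \<le> a^2 * (1 - (sqrt y)^2)^2"
    unfolding sqrt_y using uv_prod by (intro mult_left_mono) auto
  also have "\<dots> = a * (1 + sqrt y)^2 * (a * (1 - sqrt y)^2)"
    by (simp add: power2_eq_square algebra_simps)
  finally show "4 * a * u * (4 * a * v) \<le> a * (1 + sqrt y)^2 * (a * (1 - sqrt y)^2)" .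
qed (use a_range uv_range in auto)

lemma sector_entropy_le_max_antipodal:
  fixes a u v l m :: real
  defines "s \<equiv> u + v"
  assumes a_range: "0 < a" "a \<le> 1/4" and uv_range: "0 \<le> u" "0 \<le> v" "1/2 \<le> s" "s \<le> 1"
    and uv_le: "4 * (u * v) \<le> (1 - s)^2" and lm_nonneg: "0 \<le> l" "0 \<le> m"
    and sum_eq: "l + m = 1 - 4 * a * s" and prod_eq: "l * m = 16 * a * (1 - 3 * a) * (u * v)"
  shows "eta_ln (4 * a * u) + eta_ln (4 * a * v) + eta_ln l + eta_ln m
    \<le> max (product_entropy a) (bell_entropy a)"
proof -
  define y where "y = 2 * s - 1"
  have y_range: "0 \<le> y" "y \<le> 1" "s = (1 + y) / 2" using uv_range by (auto simp: y_def)
  have uv_le': "16 * (u * v) \<le> (1 - y)^2"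
    using uv_le by (simp add: y_range(3) power2_eq_square algebra_simps)
  define t where "t = 1 - 2 * a - 2 * a * y"
  define d where "d = (1 - y)^2 * a * (1 - 3 * a)"
  have t_eq: "l + m = t" using sum_eq by (simp add: t_def y_range(3) field_simps)
  have "t^2 - 4 * d = (1 - 4 * a) * (1 - 4 * a + 4 * a * (y * (1 - y)))"
    by (simp add: t_def d_def power2_eq_square algebra_simps)
  also have "\<dots> \<ge> 0" using a_range y_range by simp
  finally have "4 * d \<le> t^2" by simp
  moreover have "0 \<le> t" "0 \<le> d" using t_eq lm_nonneg a_range by (auto simp: d_def)
  ultimately obtain l' m' where l'm'_spec: "0 \<le> m'" "m' \<le> l'" "l' + m' = t" "l' * m' = d"
    using nonneg_pair_with_sum_prod by metis
  interpret spectrum: antipodal_spectrum a y l' m' "1 - 3 * a - l'"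
    using a_range y_range l'm'_spec by unfold_locales (auto simp: t_def d_def)
  have "eta_ln l + eta_ln m \<le> eta_ln l' + eta_ln m'"
  proof (rule eta_ln_add_mono_product)
    have "16 * (u * v) * (a * (1 - 3 * a)) \<le> (1 - y)^2 * (a * (1 - 3 * a))"
      using uv_le' a_range by (intro mult_right_mono) auto
    then show "l * m \<le> l' * m'" unfolding prod_eq l'm'_spec(4) d_def by (simp add: algebra_simps)
  qed (use lm_nonneg t_eq l'm'_spec in auto)
  moreover have "eta_ln (4 * a * u) + eta_ln (4 * a * v)
      \<le> eta_ln (a * (1 + sqrt y)^2) + eta_ln (a * (1 - sqrt y)^2)"
    using a_range y_range uv_range uv_le' by (intro eta_ln_pair_le_antipodal) (auto simp: s_def)
  ultimately show ?thesis
    using spectrum.total_entropy_le_max unfolding spectrum.total_entropy_def by linarith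
qed

lemma sector_entropy_le_max:
  fixes a p q l m :: real
  defines "u \<equiv> p * (1 - q)" and "v \<equiv> (1 - p) * q"
  assumes a_range: "0 < a" "a \<le> 1/4" and p_range: "0 \<le> p" "p \<le> 1" and q_range: "0 \<le> q" "q \<le> 1"
    and m_range: "0 \<le> m" "m \<le> l"
    and sum_eq: "l + m = 1 - 4 * a * (u + v)" and prod_eq: "l * m = 16 * a * (1 - 3 * a) * (u * v)"
  shows "eta_ln (4 * a * u) + eta_ln (4 * a * v) + eta_ln l + eta_ln m
    \<le> max (product_entropy a) (bell_entropy a)"
proof -
  have uv_range: "0 \<le> u" "0 \<le> v" using p_range q_range by (auto simp: u_def v_def)
  have complement: "1 - (u + v) = p * q + (1 - p) * (1 - q)"
    by (simp add: u_def v_def algebra_simps)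
  also have "\<dots> \<ge> 0" using p_range q_range by simp
  finally have "u + v \<le> 1" by simp
  have "4 * (u * v) \<le> (1 - (u + v))^2"
    unfolding complement using zero_le_power2[of "p * q - (1 - p) * (1 - q)"]
    by (simp add: u_def v_def power2_eq_square algebra_simps)
  then show ?thesis
    using sector_entropy_le_bell_entropy[OF a_range uv_range _ m_range sum_eq prod_eq]
      sector_entropy_le_max_antipodal[OF a_range uv_range _ \<open>u + v \<le> 1\<close> _ _ _ sum_eq prod_eq]
      m_range
    by (cases "u + v \<le> 1/2") auto
qed

section \<open>Unitary diagonalisation\<close>

notation mat_adjoint ("_\<^sup>\<dagger>" [1000] 1000)

lemma mat_adjoint_dim [simp]: "dim_row A\<^sup>\<dagger> = dim_col A" "dim_col A\<^sup>\<dagger> = dim_row A"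
  by (simp_all add: mat_adjoint_def)

lemma mat_adjoint_carrier [simp]: "A \<in> carrier_mat n m \<Longrightarrow> A\<^sup>\<dagger> \<in> carrier_mat m n"
  by auto

lemma mat_adjoint_index [simp]:
  "i < dim_col A \<Longrightarrow> j < dim_row A \<Longrightarrow> A\<^sup>\<dagger> $$ (i, j) = cnj (A $$ (j, i))"
  by (simp add: mat_adjoint_def mat_of_rows_index)

lemma mat_adjoint_mat_adjoint [simp]: "(A :: complex mat)\<^sup>\<dagger>\<^sup>\<dagger> = A"
  by (rule eq_matI) auto

lemma index_mult_mat_sum:
  assumes "A \<in> carrier_mat n m" "B \<in> carrier_mat m k" "i < n" "j < k"
  shows "(A * B) $$ (i, j) = (\<Sum>l<m. A $$ (i, l) * B $$ (l, j))"
  using assms by (auto simp: scalar_prod_def atLeast0LessThan)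

lemma mat_adjoint_mult:
  fixes A B :: "complex mat"
  assumes A: "A \<in> carrier_mat n m" and B: "B \<in> carrier_mat m k"
  shows "(A * B)\<^sup>\<dagger> = B\<^sup>\<dagger> * A\<^sup>\<dagger>"
proof (rule eq_matI)
  fix i j assume "i < dim_row (B\<^sup>\<dagger> * A\<^sup>\<dagger>)" "j < dim_col (B\<^sup>\<dagger> * A\<^sup>\<dagger>)"
  then have "i < k" "j < n" using assms by auto
  then show "(A * B)\<^sup>\<dagger> $$ (i, j) = (B\<^sup>\<dagger> * A\<^sup>\<dagger>) $$ (i, j)"
    using assms
    by (simp add: index_mult_mat_sum[OF A B]
        index_mult_mat_sum[OF mat_adjoint_carrier[OF B] mat_adjoint_carrier[OF A]] mult.commute
        del: index_mult_mat(1))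
qed (use assms in auto)

lemma mat_adjoint_congruence:
  fixes A B :: "complex mat"
  assumes A: "A \<in> carrier_mat n n" and B: "B \<in> carrier_mat n m"
  shows "(B\<^sup>\<dagger> * A * B)\<^sup>\<dagger> = B\<^sup>\<dagger> * A\<^sup>\<dagger> * B"
proof -
  note B' = mat_adjoint_carrier[OF B]
  have "(B\<^sup>\<dagger> * A * B)\<^sup>\<dagger> = B\<^sup>\<dagger> * (B\<^sup>\<dagger> * A)\<^sup>\<dagger>"
    by (rule mat_adjoint_mult[OF mult_carrier_mat[OF B' A] B])
  also have "(B\<^sup>\<dagger> * A)\<^sup>\<dagger> = A\<^sup>\<dagger> * B"
    by (simp add: mat_adjoint_mult[OF B' A])
  also have "B\<^sup>\<dagger> * (A\<^sup>\<dagger> * B) = B\<^sup>\<dagger> * A\<^sup>\<dagger> * B"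
    by (rule assoc_mult_mat[OF B' mat_adjoint_carrier[OF A] B, symmetric])
  finally show ?thesis .
qed

lemma congruence_mult:
  fixes A B C :: "complex mat"
  assumes A: "A \<in> carrier_mat n n" and B: "B \<in> carrier_mat n m" and C: "C \<in> carrier_mat m k"
  shows "(B * C)\<^sup>\<dagger> * A * (B * C) = C\<^sup>\<dagger> * (B\<^sup>\<dagger> * A * B) * C"
proof -
  note B' = mat_adjoint_carrier[OF B] and C' = mat_adjoint_carrier[OF C]
  have "(B * C)\<^sup>\<dagger> * A * (B * C) = C\<^sup>\<dagger> * (B\<^sup>\<dagger> * A) * (B * C)"
    by (simp only: mat_adjoint_mult[OF B C] assoc_mult_mat[OF C' B' A])
  also have "\<dots> = C\<^sup>\<dagger> * (B\<^sup>\<dagger> * A) * B * C"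
    by (rule assoc_mult_mat[symmetric, of _ k n _ m]) (use A B C B' C' in auto)
  also have "C\<^sup>\<dagger> * (B\<^sup>\<dagger> * A) * B = C\<^sup>\<dagger> * (B\<^sup>\<dagger> * A * B)"
    by (rule assoc_mult_mat[of _ k m _ n]) (use A B C B' C' in auto)
  finally show ?thesis .
qed

definition unitary_mat :: "nat \<Rightarrow> complex mat \<Rightarrow> bool" where
  "unitary_mat n U \<longleftrightarrow> U \<in> carrier_mat n n \<and> U\<^sup>\<dagger> * U = 1\<^sub>m n"

lemma unitary_matD:
  assumes "unitary_mat n U"
  shows "U \<in> carrier_mat n n" "U\<^sup>\<dagger> \<in> carrier_mat n n" "U\<^sup>\<dagger> * U = 1\<^sub>m n" "U * U\<^sup>\<dagger> = 1\<^sub>m n"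
  using assms mat_mult_left_right_inverse[of "U\<^sup>\<dagger>" n U] by (auto simp: unitary_mat_def)

lemma unitary_mat_adjoint:
  assumes "unitary_mat n U"
  shows "unitary_mat n U\<^sup>\<dagger>"
  using unitary_matD[OF assms] by (simp add: unitary_mat_def)

lemma unitary_mat_mult:
  assumes "unitary_mat n U" "unitary_mat n V"
  shows "unitary_mat n (U * V)"
proof -
  note U = unitary_matD[OF assms(1)] and V = unitary_matD[OF assms(2)]
  have "(U * V)\<^sup>\<dagger> * (U * V) = V\<^sup>\<dagger> * (U\<^sup>\<dagger> * (U * V))"
    using U V mult_carrier_mat[OF U(1) V(1)]
    by (simp add: mat_adjoint_mult[OF U(1) V(1)] assoc_mult_mat[of _ n n _ n _ n])
  also have "U\<^sup>\<dagger> * (U * V) = U\<^sup>\<dagger> * U * V"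
    using U V by (intro assoc_mult_mat[symmetric])
  also have "V\<^sup>\<dagger> * \<dots> = V\<^sup>\<dagger> * V" using U V by simp
  also have "\<dots> = 1\<^sub>m n" using U V by simp
  finally show ?thesis using U V by (simp add: unitary_mat_def)
qed

lemma index_gram:
  fixes G :: "complex mat"
  assumes G: "G \<in> carrier_mat n m" and "i < n" "j < n"
  shows "(G * G\<^sup>\<dagger>) $$ (i, j) = (\<Sum>k<m. G $$ (i, k) * cnj (G $$ (j, k)))"
  unfolding index_mult_mat_sum[OF G mat_adjoint_carrier[OF G] assms(2,3)]
  using assms by (intro sum.cong) auto

lemma index_adjoint_mult_self:
  fixes X :: "complex mat"
  assumes X: "X \<in> carrier_mat n m" and "k < m" "l < m"
  shows "(X\<^sup>\<dagger> * X) $$ (k, l) = (\<Sum>i<n. cnj (X $$ (i, k)) * X $$ (i, l))"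
  unfolding index_mult_mat_sum[OF mat_adjoint_carrier[OF X] X assms(2,3)]
  using assms by (intro sum.cong) auto

lemma gram_hermitian:
  fixes G :: "complex mat"
  shows "G \<in> carrier_mat n m \<Longrightarrow> (G * G\<^sup>\<dagger>)\<^sup>\<dagger> = G * G\<^sup>\<dagger>"
  using mat_adjoint_mult[of G n m "G\<^sup>\<dagger>" n] by simp

lemma orthogonal_basis_with_first:
  fixes v :: "complex vec"
  assumes v: "v \<in> carrier_vec n" "v \<noteq> 0\<^sub>v n"
  obtains ws where "set ws \<subseteq> carrier_vec n" "corthogonal ws" "length ws = n" "ws ! 0 = v"
proof -
  interpret cof_vec_space n "TYPE(complex)" .
  define ws where "ws = gram_schmidt n (basis_completion v)"
  note basis = basis_completion[OF v]
  have ws: "set ws \<subseteq> carrier_vec n" "corthogonal ws" "length ws = n"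
    using gram_schmidt_result[OF basis(2,4,5) ws_def] basis(6) by auto
  have n: "0 < n" using v by (cases n) auto
  have "basis_completion v \<noteq> []" using basis(6) n by auto
  then obtain vs where basis_eq: "basis_completion v = v # vs"
    using basis(7) by (cases "basis_completion v") auto
  have "hd ws = v" unfolding ws_def basis_eq by (rule gram_schmidt_hd[OF v(1)])
  then have "ws ! 0 = v" using ws n by (cases ws) auto
  with ws show ?thesis by (rule that)
qed

definition normalized_cols :: "nat \<Rightarrow> complex vec list \<Rightarrow> complex mat" where
  "normalized_cols n ws
    = mat n n (\<lambda>(k, i). ws ! i $ k / complex_of_real (sqrt (\<Sum>j<n. (cmod (ws ! i $ j))^2)))"

lemma unitary_normalized_cols:
  assumes ws: "set ws \<subseteq> carrier_vec n" "corthogonal ws" "length ws = n"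
  shows "unitary_mat n (normalized_cols n ws)"
proof -
  let ?W = "normalized_cols n ws"
  have W: "?W \<in> carrier_mat n n" by (simp add: normalized_cols_def)
  define r where "r i = sqrt (\<Sum>j<n. (cmod (ws ! i $ j))^2)" for i
  have inner: "(\<Sum>k<n. cnj (ws ! i $ k) * ws ! j $ k) = ws ! j \<bullet>c ws ! i" if "i < n" for i j
  proof -
    have "ws ! i \<in> carrier_vec n" using ws that by auto
    then show ?thesis by (simp add: scalar_prod_def atLeast0LessThan mult.commute)
  qed
  have inner_self: "(\<Sum>k<n. cnj (ws ! i $ k) * ws ! i $ k) = complex_of_real (r i) * r i" for i
  proof -
    have "r i * r i = (\<Sum>k<n. (cmod (ws ! i $ k))^2)" by (simp add: r_def sum_nonneg)
    then show ?thesis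
      by (simp only: of_real_mult[symmetric] of_real_sum complex_norm_square mult.commute)
  qed
  have "?W\<^sup>\<dagger> * ?W = 1\<^sub>m n"
  proof (rule eq_matI)
    fix i j assume "i < dim_row (1\<^sub>m n :: complex mat)" "j < dim_col (1\<^sub>m n :: complex mat)"
    then have ij: "i < n" "j < n" by auto
    have "(?W\<^sup>\<dagger> * ?W) $$ (i, j) = (\<Sum>k<n. cnj (ws ! i $ k) * ws ! j $ k) / (r i * r j)"
      unfolding index_mult_mat_sum[OF mat_adjoint_carrier[OF W] W ij] sum_divide_distrib
      using ij by (intro sum.cong) (auto simp: normalized_cols_def r_def)
    also have "\<dots> = 1\<^sub>m n $$ (i, j)"
      using ij ws corthogonalD[OF ws(2), of j i] inner[OF ij(1)] inner_self[of i] by auto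
    finally show "(?W\<^sup>\<dagger> * ?W) $$ (i, j) = 1\<^sub>m n $$ (i, j)" .
  qed (use W in auto)
  with W show ?thesis by (simp add: unitary_mat_def)
qed

lemma unitary_mat_with_first_col:
  assumes v: "v \<in> carrier_vec n" "v \<noteq> 0\<^sub>v n"
  obtains W c where "unitary_mat n W" "col W 0 = c \<cdot>\<^sub>v v"
proof -
  obtain ws where ws: "set ws \<subseteq> carrier_vec n" "corthogonal ws" "length ws = n" and hd: "ws ! 0 = v"
    by (rule orthogonal_basis_with_first[OF v])
  have "0 < n" using v by (cases n) auto
  then have "col (normalized_cols n ws) 0
      = complex_of_real (1 / sqrt (\<Sum>j<n. (cmod (v $ j))^2)) \<cdot>\<^sub>v v"
    using v by (intro eq_vecI) (auto simp: normalized_cols_def hd)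
  with unitary_normalized_cols[OF ws] show ?thesis by (rule that)
qed

lemma eigenvector_exists:
  fixes A :: "complex mat"
  assumes A: "A \<in> carrier_mat n n" and n: "0 < n"
  obtains v l where "v \<in> carrier_vec n" "v \<noteq> 0\<^sub>v n" "A *\<^sub>v v = l \<cdot>\<^sub>v v"
proof -
  have "degree (char_poly A) \<noteq> 0" using degree_monic_char_poly[OF A] n by simp
  then obtain l where "poly (char_poly A) l = 0"
    using fundamental_theorem_of_algebra[of "char_poly A"] by (auto simp: constant_degree)
  then have "eigenvalue A l" using eigenvalue_root_char_poly[OF A] by simp
  then show ?thesis using that A by (auto simp: eigenvalue_def eigenvector_def)
qed

definition direct_sum_mat :: "complex mat \<Rightarrow> complex mat \<Rightarrow> complex mat" where
  "direct_sum_mat A B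
    = four_block_mat A (0\<^sub>m (dim_row A) (dim_col B)) (0\<^sub>m (dim_row B) (dim_col A)) B"

lemma direct_sum_mat_carrier [simp]:
  "A \<in> carrier_mat n n \<Longrightarrow> B \<in> carrier_mat m m \<Longrightarrow> direct_sum_mat A B \<in> carrier_mat (n + m) (n + m)"
  by (auto simp: direct_sum_mat_def)

lemma direct_sum_mat_mult:
  assumes "A \<in> carrier_mat n n" "B \<in> carrier_mat m m" "C \<in> carrier_mat n n" "D \<in> carrier_mat m m"
  shows "direct_sum_mat A B * direct_sum_mat C D = direct_sum_mat (A * C) (B * D)"
  using assms unfolding direct_sum_mat_def
  by (subst mult_four_block_mat[of _ n n _ m _ m _ _ n _ m]) auto

lemma direct_sum_mat_adjoint:
  assumes "A \<in> carrier_mat n n" "B \<in> carrier_mat m m"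
  shows "(direct_sum_mat A B)\<^sup>\<dagger> = direct_sum_mat A\<^sup>\<dagger> B\<^sup>\<dagger>"
  using assms by (intro eq_matI) (auto simp: direct_sum_mat_def)

lemma direct_sum_mat_one: "direct_sum_mat (1\<^sub>m n) (1\<^sub>m m) = 1\<^sub>m (n + m)"
  by (simp add: direct_sum_mat_def)

lemma diagonal_direct_sum_mat:
  assumes "A \<in> carrier_mat n n" "B \<in> carrier_mat m m" "diagonal_mat A" "diagonal_mat B"
  shows "diagonal_mat (direct_sum_mat A B)"
  using assms by (auto simp: direct_sum_mat_def diagonal_mat_def)

lemma mat_adjoint_one [simp]: "(1\<^sub>m n :: complex mat)\<^sup>\<dagger> = 1\<^sub>m n"
  by (rule eq_matI) auto

lemma mat_adjoint_zero [simp]: "(0\<^sub>m n m :: complex mat)\<^sup>\<dagger> = 0\<^sub>m m n"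
  by (rule eq_matI) auto

lemma unitary_one: "unitary_mat n (1\<^sub>m n)"
  by (simp add: unitary_mat_def)

lemma unitary_direct_sum_mat:
  assumes "unitary_mat n U" "unitary_mat m V"
  shows "unitary_mat (n + m) (direct_sum_mat U V)"
proof -
  note U = unitary_matD[OF assms(1)] and V = unitary_matD[OF assms(2)]
  have "(direct_sum_mat U V)\<^sup>\<dagger> * direct_sum_mat U V = direct_sum_mat (U\<^sup>\<dagger> * U) (V\<^sup>\<dagger> * V)"
    unfolding direct_sum_mat_adjoint[OF U(1) V(1)]
    by (rule direct_sum_mat_mult[OF U(2) V(2) U(1) V(1)])
  with U V show ?thesis by (simp add: unitary_mat_def direct_sum_mat_one)
qed

lemma col_congruence_eigenvector:
  assumes unitary: "unitary_mat n W" and n: "0 < n" and A: "A \<in> carrier_mat n n"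
    and eigen: "A *\<^sub>v col W 0 = l \<cdot>\<^sub>v col W 0"
  shows "col (W\<^sup>\<dagger> * A * W) 0 = l \<cdot>\<^sub>v unit_vec n 0"
proof -
  note W = unitary_matD[OF unitary]
  have col_W: "col W 0 \<in> carrier_vec n" using W(1) n by auto
  have "col (W\<^sup>\<dagger> * A * W) 0 = W\<^sup>\<dagger> * A *\<^sub>v col W 0"
    using W A n by (intro col_mult2) auto
  also have "\<dots> = W\<^sup>\<dagger> *\<^sub>v (A *\<^sub>v col W 0)"
    by (rule assoc_mult_mat_vec[OF W(2) A col_W])
  also have "\<dots> = l \<cdot>\<^sub>v (W\<^sup>\<dagger> *\<^sub>v col W 0)"
    unfolding eigen by (rule mult_mat_vec[OF W(2) col_W])
  also have "W\<^sup>\<dagger> *\<^sub>v col W 0 = col (W\<^sup>\<dagger> * W) 0"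
    using W n by (intro col_mult2[symmetric]) auto
  finally show ?thesis using W n by simp
qed

lemma hermitian_first_col_split:
  fixes C :: "complex mat"
  assumes C: "C \<in> carrier_mat (Suc m) (Suc m)" "C\<^sup>\<dagger> = C"
    and col: "col C 0 = l \<cdot>\<^sub>v unit_vec (Suc m) 0"
  obtains L B where "L \<in> carrier_mat 1 1" "B \<in> carrier_mat m m" "B\<^sup>\<dagger> = B" "C = direct_sum_mat L B"
proof -
  have adjoint_index: "cnj (C $$ (j, i)) = C $$ (i, j)" if "i < Suc m" "j < Suc m" for i j
    using that C(1) by (subst (2) C(2)[symmetric]) auto
  have col0: "C $$ (i, 0) = (if i = 0 then l else 0)" if "i < Suc m" for i
    using that C(1) col index_col[of i C 0] by (auto split: if_splits)
  then have row0: "C $$ (0, i) = (if i = 0 then cnj l else 0)" if "i < Suc m" for i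
    using that adjoint_index[of 0 i] by auto
  define L where "L = mat 1 1 (\<lambda>_. l)"
  define B where "B = mat m m (\<lambda>(i, j). C $$ (Suc i, Suc j))"
  have B_herm: "B\<^sup>\<dagger> = B"
    by (rule eq_matI) (auto simp: B_def adjoint_index)
  have C_eq: "C = direct_sum_mat L B"
  proof (rule eq_matI)
    fix i j assume "i < dim_row (direct_sum_mat L B)" "j < dim_col (direct_sum_mat L B)"
    then have "i < Suc m" "j < Suc m" by (auto simp: direct_sum_mat_def L_def B_def)
    then show "C $$ (i, j) = direct_sum_mat L B $$ (i, j)"
      by (cases i; cases j) (auto simp: direct_sum_mat_def L_def B_def col0 row0)
  qed (use C in \<open>auto simp: direct_sum_mat_def L_def B_def\<close>)
  show ?thesis
    by (rule that[OF _ _ B_herm C_eq]) (simp_all add: L_def B_def)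
qed

lemma hermitian_deflation:
  assumes A: "A \<in> carrier_mat (Suc m) (Suc m)" and herm: "A\<^sup>\<dagger> = A"
  obtains W L B where "unitary_mat (Suc m) W" "L \<in> carrier_mat 1 1"
    "B \<in> carrier_mat m m" "B\<^sup>\<dagger> = B" "W\<^sup>\<dagger> * A * W = direct_sum_mat L B"
proof -
  obtain v l where v: "v \<in> carrier_vec (Suc m)" "v \<noteq> 0\<^sub>v (Suc m)" "A *\<^sub>v v = l \<cdot>\<^sub>v v"
    by (rule eigenvector_exists[OF A zero_less_Suc])
  obtain W c where unitary: "unitary_mat (Suc m) W" and col_W: "col W 0 = c \<cdot>\<^sub>v v"
    by (rule unitary_mat_with_first_col[OF v(1,2)])
  note W = unitary_matD[OF unitary]
  have "A *\<^sub>v col W 0 = l \<cdot>\<^sub>v col W 0"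
    by (simp add: col_W mult_mat_vec[OF A v(1)] v(3) smult_smult_assoc mult.commute)
  then have col: "col (W\<^sup>\<dagger> * A * W) 0 = l \<cdot>\<^sub>v unit_vec (Suc m) 0"
    by (rule col_congruence_eigenvector[OF unitary zero_less_Suc A])
  have carrier: "W\<^sup>\<dagger> * A * W \<in> carrier_mat (Suc m) (Suc m)"
    using W(1) by auto
  have "(W\<^sup>\<dagger> * A * W)\<^sup>\<dagger> = W\<^sup>\<dagger> * A * W"
    unfolding mat_adjoint_congruence[OF A W(1)] herm ..
  from hermitian_first_col_split[OF carrier this col] show ?thesis
    using that[OF unitary] by metis
qed

theorem hermitian_unitarily_diagonalizable:
  assumes "A \<in> carrier_mat n n" "A\<^sup>\<dagger> = A"
  obtains U where "unitary_mat n U" "diagonal_mat (U\<^sup>\<dagger> * A * U)"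
  using assms
proof (induction n arbitrary: A thesis)
  case 0
  then show ?case by (intro 0(1)[of "1\<^sub>m 0"]) (auto simp: unitary_mat_def diagonal_mat_def)
next
  case (Suc m)
  obtain W L B where unitary_W: "unitary_mat (Suc m) W" and L: "L \<in> carrier_mat 1 1"
    and B: "B \<in> carrier_mat m m" "B\<^sup>\<dagger> = B" and WAW: "W\<^sup>\<dagger> * A * W = direct_sum_mat L B"
    by (rule hermitian_deflation[OF Suc.prems(2,3)])
  obtain V where unitary_V: "unitary_mat m V" and diag: "diagonal_mat (V\<^sup>\<dagger> * B * V)"
    using Suc.IH[OF _ B] by blast
  note V = unitary_matD[OF unitary_V]
  define P where "P = direct_sum_mat (1\<^sub>m 1) V"
  have unitary_P: "unitary_mat (Suc m) P"
    using unitary_direct_sum_mat[OF unitary_one[of 1] unitary_V] by (simp add: P_def)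
  note W = unitary_matD[OF unitary_W] and P = unitary_matD[OF unitary_P]
  have "(W * P)\<^sup>\<dagger> * A * (W * P) = P\<^sup>\<dagger> * (W\<^sup>\<dagger> * A * W) * P"
    by (rule congruence_mult[OF Suc.prems(2) W(1) P(1)])
  also have "\<dots> = direct_sum_mat L (V\<^sup>\<dagger> * B * V)"
    unfolding WAW P_def using V L B
    by (simp add: direct_sum_mat_adjoint[of _ 1 _ m] direct_sum_mat_mult[of _ 1 _ m]
        mult_carrier_mat[of _ m m _ m] del: One_nat_def)
  also have "diagonal_mat \<dots>"
  proof (rule diagonal_direct_sum_mat[OF L _ _ diag])
    show "V\<^sup>\<dagger> * B * V \<in> carrier_mat m m" using V B by (intro mult_carrier_mat) auto
    show "diagonal_mat L" using L by (auto simp: diagonal_mat_def)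
  qed
  finally have "diagonal_mat ((W * P)\<^sup>\<dagger> * A * (W * P))" .
  then show ?case
    using Suc.prems(1) unitary_mat_mult[OF unitary_W unitary_P] by blast
qed

section \<open>Von Neumann entropy of Gram matrices\<close>

lemma sum_mset_image_eq_sum: "(\<Sum>x\<in>#M. f x) = (\<Sum>x\<in>set_mset M. real (count M x) * f x)"
proof (induction M)
  case (add x M)
  have "(\<Sum>y\<in>insert x (set_mset M). real (count (add_mset x M) y) * f y)
      = (\<Sum>y\<in>insert x (set_mset M). (if y = x then f x else 0) + real (count M y) * f y)"
    by (intro sum.cong) (auto simp: algebra_simps)
  also have "\<dots> = f x + (\<Sum>y\<in>insert x (set_mset M). real (count M y) * f y)"
    by (simp add: sum.distrib)
  also have "(\<Sum>y\<in>insert x (set_mset M). real (count M y) * f y)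
      = (\<Sum>y\<in>set_mset M. real (count M y) * f y)"
    by (rule sum.mono_neutral_right) (auto simp: not_in_iff)
  finally show ?case using add by simp
qed simp

lemma char_poly_neq_0: "A \<in> carrier_mat n n \<Longrightarrow> char_poly A \<noteq> 0"
  using degree_monic_char_poly[of A n] by auto

lemma vn_entropy_eq_sum_proots:
  assumes "A \<in> carrier_mat n n"
  shows "vn_entropy A = (\<Sum>l\<in>#proots (char_poly A). eta (Re l))"
  using char_poly_neq_0[OF assms] by (simp add: vn_entropy_def sum_mset_image_eq_sum)

lemma char_poly_matrix_mult:
  fixes A B :: "'a :: comm_ring_1 mat"
  assumes A: "A \<in> carrier_mat n m" and B: "B \<in> carrier_mat m n"
  shows "char_poly_matrix (A * B)
    = [:0, 1:] \<cdot>\<^sub>m 1\<^sub>m n - map_mat (\<lambda>a. [:a:]) A * map_mat (\<lambda>a. [:a:]) B"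
  using A B unfolding char_poly_matrix_def map_poly_mult(1)[OF A B, symmetric]
  by (intro eq_matI) auto

lemma char_poly_mult_commute:
  fixes A B :: "'a :: idom mat"
  assumes A: "A \<in> carrier_mat n m" and B: "B \<in> carrier_mat m n"
  shows "[:0, 1:] ^ m * char_poly (A * B) = [:0, 1:] ^ n * char_poly (B * A)"
proof -
  let ?l = "map_mat (\<lambda>a::'a. [:a:])"
  let ?X = "[:0, 1::'a:]"
  define A' B' where "A' = ?l A" and "B' = ?l B"
  have A': "A' \<in> carrier_mat n m" and B': "B' \<in> carrier_mat m n"
    using A B by (auto simp: A'_def B'_def)
  define M where "M = four_block_mat (?X \<cdot>\<^sub>m 1\<^sub>m n) A' B' (1\<^sub>m m)"
  define N where "N = four_block_mat (1\<^sub>m n) (0\<^sub>m n m) (- B') (1\<^sub>m m)"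
  define K where "K = four_block_mat (1\<^sub>m n) (0\<^sub>m n m) (- B') (?X \<cdot>\<^sub>m 1\<^sub>m m)"
  have carrier: "M \<in> carrier_mat (n + m) (n + m)" "N \<in> carrier_mat (n + m) (n + m)"
    "K \<in> carrier_mat (n + m) (n + m)"
    using A' B' by (auto simp: M_def N_def K_def)
  have "det N = 1" "det K = ?X ^ m"
    unfolding N_def K_def
    by (subst det_four_block_mat_upper_right_zero[of _ n _ m]; use B' in simp)+
  have "M * N = four_block_mat (char_poly_matrix (A * B)) A' (0\<^sub>m m n) (1\<^sub>m m)"
    unfolding M_def N_def char_poly_matrix_mult[OF A B] A'_def[symmetric] B'_def[symmetric]
    by (subst mult_four_block_mat[of _ n n _ m _ m _ _ n _ m])
      (use A' B' in \<open>auto simp: minus_add_uminus_mat[symmetric]\<close>)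
  then have "det (M * N) = char_poly (A * B)"
    using det_four_block_mat_lower_left_zero[of _ n A' m _ "1\<^sub>m m"] A B A'
    by (simp add: char_poly_def)
  with \<open>det N = 1\<close> have det_M: "det M = char_poly (A * B)"
    using det_mult[OF carrier(1,2)] by simp
  have "K * M = four_block_mat (?X \<cdot>\<^sub>m 1\<^sub>m n) A' (0\<^sub>m m n) (char_poly_matrix (B * A))"
    unfolding M_def K_def char_poly_matrix_mult[OF B A] A'_def[symmetric] B'_def[symmetric]
    by (subst mult_four_block_mat[of _ n n _ m _ m _ _ n _ m])
      (use A' B' in \<open>auto simp: minus_add_uminus_mat[symmetric]\<close>)
  then have "det (K * M) = ?X ^ n * char_poly (B * A)"
    using det_four_block_mat_lower_left_zero[of _ n A' m _ "char_poly_matrix (B * A)"] A B A'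
    by (simp add: char_poly_def)
  with \<open>det K = ?X ^ m\<close> show ?thesis
    using det_mult[OF carrier(3,1)] det_M by simp
qed

lemma vn_entropy_mult_commute:
  assumes A: "A \<in> carrier_mat n m" and B: "B \<in> carrier_mat m n"
  shows "vn_entropy (A * B) = vn_entropy (B * A)"
proof -
  define S where "S p = (\<Sum>l\<in>#proots p. eta (Re l))" for p
  have S_X_power: "S ([:0, 1:] ^ k * p) = S p" if "p \<noteq> 0" for k p
  proof (induction k)
    case (Suc k)
    have "proots ([:0, 1:] ^ Suc k * p) = {#0#} + proots ([:0, 1:] ^ k * p)"
      using proots_mult[of "[:0, 1:]" "[:0, 1:] ^ k * p"] that
      by (simp add: mult.assoc del: mult_pCons_left)
    then have "S ([:0, 1:] ^ Suc k * p) = eta 0 + S ([:0, 1:] ^ k * p)" by (simp add: S_def)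
    then show ?case using Suc by (simp add: eta_def)
  qed simp
  have AB: "A * B \<in> carrier_mat n n" and BA: "B * A \<in> carrier_mat m m" using A B by auto
  have "S (char_poly (A * B)) = S ([:0, 1:] ^ m * char_poly (A * B))"
    by (rule S_X_power[OF char_poly_neq_0[OF AB], symmetric])
  also have "\<dots> = S (char_poly (B * A))"
    unfolding char_poly_mult_commute[OF A B] by (rule S_X_power[OF char_poly_neq_0[OF BA]])
  finally show ?thesis
    by (simp add: S_def vn_entropy_eq_sum_proots[OF AB] vn_entropy_eq_sum_proots[OF BA])
qed

lemma vn_entropy_upper_triangular:
  assumes A: "A \<in> carrier_mat n n" and "upper_triangular A"
  shows "vn_entropy A = (\<Sum>i<n. eta (Re (A $$ (i, i))))"
proof -
  have "char_poly A = (\<Prod>a\<leftarrow>diag_mat A. [:- a, 1:])"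
    by (rule char_poly_upper_triangular[OF assms])
  also have "proots \<dots> = (\<Sum>a\<leftarrow>diag_mat A. proots [:- a, 1:])"
    using proots_prod_list[of "map (\<lambda>a. [:- a, 1:]) (diag_mat A)"] by (simp add: image_iff o_def)
  finally have "vn_entropy A = (\<Sum>a\<leftarrow>diag_mat A. eta (Re a))"
    unfolding vn_entropy_eq_sum_proots[OF A] by (simp add: sum_mset_sum_list flip: mset_map)
  then show ?thesis
    using A by (simp add: diag_mat_def interv_sum_list_conv_sum_set_nat atLeast0LessThan o_def)
qed

lemma vn_entropy_diagonal:
  assumes "A \<in> carrier_mat n n" "diagonal_mat A"
  shows "vn_entropy A = (\<Sum>i<n. eta (Re (A $$ (i, i))))"
  using assms
  by (intro vn_entropy_upper_triangular) (auto simp: diagonal_mat_def upper_triangular_def)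

lemma det_2x2:
  assumes A: "A \<in> carrier_mat 2 2"
  shows "det A = A $$ (0, 0) * A $$ (1, 1) - A $$ (0, 1) * A $$ (1, 0)"
proof -
  have "det (mat_delete A 0 0) = A $$ (1, 1)" "det (mat_delete A 0 1) = A $$ (1, 0)"
    using A by (subst det_single; simp add: mat_delete_def)+
  then show ?thesis
    using laplace_expansion_row[OF A, of 0] by (simp add: cofactor_def numeral_2_eq_2)
qed

lemma vn_entropy_2x2:
  assumes A: "A \<in> carrier_mat 2 2"
    and trace: "A $$ (0, 0) + A $$ (1, 1) = complex_of_real (l + m)"
    and det: "A $$ (0, 0) * A $$ (1, 1) - A $$ (0, 1) * A $$ (1, 0) = complex_of_real (l * m)"
  shows "vn_entropy A = eta l + eta m"
proof -
  have "char_poly A = [:A $$ (0, 0) * A $$ (1, 1) - A $$ (0, 1) * A $$ (1, 0),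
      - (A $$ (0, 0) + A $$ (1, 1)), 1:]"
    using A by (simp add: char_poly_def char_poly_matrix_def det_2x2 algebra_simps)
  also have "\<dots> = [:- complex_of_real l, 1:] * [:- complex_of_real m, 1:]"
    unfolding trace det by (simp add: algebra_simps)
  finally have "proots (char_poly A) = {#complex_of_real l, complex_of_real m#}"
    by (simp add: proots_mult del: mult_pCons_left mult_pCons_right)
  then show ?thesis by (simp add: vn_entropy_eq_sum_proots[OF A])
qed

definition row_weight :: "complex mat \<Rightarrow> nat \<Rightarrow> real" where
  "row_weight G i = (\<Sum>k<dim_col G. (cmod (G $$ (i, k)))^2)"

lemma row_weight_nonneg [simp]: "0 \<le> row_weight G i"
  by (simp add: row_weight_def sum_nonneg)

lemma of_real_row_weight:
  "G \<in> carrier_mat n m \<Longrightarrow> complex_of_real (row_weight G i) = (\<Sum>k<m. G $$ (i, k) * cnj (G $$ (i, k)))"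
  by (simp only: row_weight_def carrier_matD of_real_sum complex_norm_square)

lemma gram_diag_eq_row_weight:
  assumes "G \<in> carrier_mat n m" "i < n"
  shows "(G * G\<^sup>\<dagger>) $$ (i, i) = complex_of_real (row_weight G i)"
  unfolding index_gram[OF assms(1,2,2)] of_real_row_weight[OF assms(1)] ..

lemma sum_row_weight_gram_cong:
  assumes G: "G \<in> carrier_mat n k" and H: "H \<in> carrier_mat m k" and eq: "G\<^sup>\<dagger> * G = H\<^sup>\<dagger> * H"
  shows "(\<Sum>i<n. row_weight G i) = (\<Sum>i<m. row_weight H i)"
proof -
  have trace: "complex_of_real (\<Sum>i<l. row_weight X i) = (\<Sum>j<k. (X\<^sup>\<dagger> * X) $$ (j, j))"
    if X: "X \<in> carrier_mat l k" for X l
  proof -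
    have "complex_of_real (\<Sum>i<l. row_weight X i) = (\<Sum>i<l. \<Sum>j<k. cnj (X $$ (i, j)) * X $$ (i, j))"
      unfolding of_real_sum of_real_row_weight[OF X] by (simp only: mult.commute)
    also have "\<dots> = (\<Sum>j<k. \<Sum>i<l. cnj (X $$ (i, j)) * X $$ (i, j))" by (rule sum.swap)
    finally show ?thesis by (simp add: index_adjoint_mult_self[OF X] del: index_mult_mat(1))
  qed
  show ?thesis
    using trans[OF trace[OF G, unfolded eq] trace[OF H, symmetric]] by (simp only: of_real_eq_iff)
qed

lemma gram_mult_isometry:
  fixes W G :: "complex mat"
  assumes W: "W \<in> carrier_mat k n" and G: "G \<in> carrier_mat n m"
  shows "(W * G) * (W * G)\<^sup>\<dagger> = W * (G * G\<^sup>\<dagger>) * W\<^sup>\<dagger>"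
    and "W\<^sup>\<dagger> * W = 1\<^sub>m n \<Longrightarrow> (W * G)\<^sup>\<dagger> * (W * G) = G\<^sup>\<dagger> * G"
proof -
  have "(W * G) * (W * G)\<^sup>\<dagger> = W * (G * (G\<^sup>\<dagger> * W\<^sup>\<dagger>))"
    unfolding mat_adjoint_mult[OF W G] by (rule assoc_mult_mat[OF W G]) (use W G in auto)
  also have "G * (G\<^sup>\<dagger> * W\<^sup>\<dagger>) = G * G\<^sup>\<dagger> * W\<^sup>\<dagger>"
    by (rule assoc_mult_mat[symmetric, of _ n m _ n _ k]) (use W G in auto)
  also have "W * (G * G\<^sup>\<dagger> * W\<^sup>\<dagger>) = W * (G * G\<^sup>\<dagger>) * W\<^sup>\<dagger>"
    by (rule assoc_mult_mat[symmetric, of _ k n _ n _ k]) (use W G in auto)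
  finally show "(W * G) * (W * G)\<^sup>\<dagger> = W * (G * G\<^sup>\<dagger>) * W\<^sup>\<dagger>" .
  assume isometry: "W\<^sup>\<dagger> * W = 1\<^sub>m n"
  have "(W * G)\<^sup>\<dagger> * (W * G) = G\<^sup>\<dagger> * (W\<^sup>\<dagger> * (W * G))"
    unfolding mat_adjoint_mult[OF W G] by (rule assoc_mult_mat[of _ m n _ k]) (use W G in auto)
  also have "W\<^sup>\<dagger> * (W * G) = W\<^sup>\<dagger> * W * G"
    by (rule assoc_mult_mat[symmetric, of _ n k _ n _ m]) (use W G in auto)
  finally show "(W * G)\<^sup>\<dagger> * (W * G) = G\<^sup>\<dagger> * G"
    using G isometry by simp
qed

definition gram_entropy :: "complex mat \<Rightarrow> real" where
  "gram_entropy G = vn_entropy (G * G\<^sup>\<dagger>)"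

lemma gram_entropy_cong:
  assumes G: "G \<in> carrier_mat n k" and H: "H \<in> carrier_mat m k" and eq: "G\<^sup>\<dagger> * G = H\<^sup>\<dagger> * H"
  shows "gram_entropy G = gram_entropy H"
  using vn_entropy_mult_commute[OF G mat_adjoint_carrier[OF G]]
    vn_entropy_mult_commute[OF H mat_adjoint_carrier[OF H]] eq
  by (simp add: gram_entropy_def)

lemma gram_entropy_unitary_mult:
  assumes K: "unitary_mat n K" and L: "unitary_mat m L" and G: "G \<in> carrier_mat n m"
  shows "gram_entropy (K * G * L) = gram_entropy G"
proof -
  note K' = unitary_matD[OF K] and L' = unitary_matD[OF L]
  have KG: "K * G \<in> carrier_mat n m" using K' G by auto
  have "(K * G * L) * (K * G * L)\<^sup>\<dagger> = (K * G) * (K * G)\<^sup>\<dagger>"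
    using gram_mult_isometry(1)[OF KG L'(1)] by (simp only: L'(4) right_mult_one_mat[OF KG])
  then have "gram_entropy (K * G * L) = gram_entropy (K * G)"
    by (simp add: gram_entropy_def)
  also have "\<dots> = gram_entropy G"
    by (rule gram_entropy_cong[OF KG G gram_mult_isometry(2)[OF K'(1) G K'(3)]])
  finally show ?thesis .
qed

lemma unitary_mult_diagonal_gram:
  assumes G: "G \<in> carrier_mat n m"
  obtains U H where "unitary_mat n U" "H \<in> carrier_mat n m" "diagonal_mat (H * H\<^sup>\<dagger>)"
    "G = U * H" "G\<^sup>\<dagger> * G = H\<^sup>\<dagger> * H"
proof -
  have "G * G\<^sup>\<dagger> \<in> carrier_mat n n" using G by auto
  then obtain U where unitary: "unitary_mat n U" and diag: "diagonal_mat (U\<^sup>\<dagger> * (G * G\<^sup>\<dagger>) * U)"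
    using gram_hermitian[OF G] by (rule hermitian_unitarily_diagonalizable)
  note U = unitary_matD[OF unitary]
  define H where "H = U\<^sup>\<dagger> * G"
  have H: "H \<in> carrier_mat n m" using U G by (auto simp: H_def)
  have "U * H = U * U\<^sup>\<dagger> * G" unfolding H_def by (rule assoc_mult_mat[OF U(1,2) G, symmetric])
  then have G_eq: "G = U * H" using U G by simp
  have "H * H\<^sup>\<dagger> = U\<^sup>\<dagger> * (G * G\<^sup>\<dagger>) * U"
    unfolding H_def gram_mult_isometry(1)[OF U(2) G] by simp
  with diag have "diagonal_mat (H * H\<^sup>\<dagger>)" by simp
  from that[OF unitary H this G_eq] show ?thesis
    unfolding G_eq gram_mult_isometry(2)[OF U(1) H U(3)] by simp
qed

lemma gram_entropy_diagonal:
  assumes G: "G \<in> carrier_mat n m" and diag: "diagonal_mat (G * G\<^sup>\<dagger>)"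
  shows "gram_entropy G = (\<Sum>i<n. eta (row_weight G i))"
proof -
  have "G * G\<^sup>\<dagger> \<in> carrier_mat n n" using G by auto
  from vn_entropy_diagonal[OF this diag] show ?thesis
    by (simp add: gram_entropy_def gram_diag_eq_row_weight[OF G])
qed

lemma unitary_mat_doubly_stochastic:
  assumes "unitary_mat n U"
  shows "i < n \<Longrightarrow> (\<Sum>j<n. (cmod (U $$ (i, j)))^2) = 1"
    and "j < n \<Longrightarrow> (\<Sum>i<n. (cmod (U $$ (i, j)))^2) = 1"
proof -
  have row: "(\<Sum>j<n. (cmod (V $$ (i, j)))^2) = 1" if "unitary_mat n V" "i < n" for V i
  proof -
    note V = unitary_matD[OF that(1)]
    have "complex_of_real (row_weight V i) = 1"
      using that V by (simp flip: gram_diag_eq_row_weight[OF V(1)])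
    then have "row_weight V i = 1" by (simp only: of_real_eq_1_iff)
    then show ?thesis using V(1) by (simp add: row_weight_def)
  qed
  show "i < n \<Longrightarrow> (\<Sum>j<n. (cmod (U $$ (i, j)))^2) = 1" by (rule row[OF assms])
  show "(\<Sum>i<n. (cmod (U $$ (i, j)))^2) = 1" if "j < n"
    using row[OF unitary_mat_adjoint[OF assms] that] that unitary_matD(1)[OF assms] by simp
qed

lemma row_weight_unitary_mult:
  assumes U: "U \<in> carrier_mat n n" and H: "H \<in> carrier_mat n m" and diag: "diagonal_mat (H * H\<^sup>\<dagger>)"
    and i: "i < n"
  shows "row_weight (U * H) i = (\<Sum>j<n. (cmod (U $$ (i, j)))^2 * row_weight H j)"
proof -
  have UH: "U * H \<in> carrier_mat n m" and HH: "H * H\<^sup>\<dagger> \<in> carrier_mat n n" using U H by auto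
  have HH_index: "(H * H\<^sup>\<dagger>) $$ (k, j) = (if k = j then complex_of_real (row_weight H j) else 0)"
    if "k < n" "j < n" for k j
    using diag that HH gram_diag_eq_row_weight[OF H] unfolding diagonal_mat_def by auto
  have UHH_index: "(U * (H * H\<^sup>\<dagger>)) $$ (i, j) = U $$ (i, j) * row_weight H j" if "j < n" for j
  proof -
    have "(U * (H * H\<^sup>\<dagger>)) $$ (i, j) = (\<Sum>k<n. if k = j then U $$ (i, k) * row_weight H j else 0)"
      unfolding index_mult_mat_sum[OF U HH i that] using that
      by (intro sum.cong) (auto simp: HH_index)
    then show ?thesis using that by simp
  qed
  have "complex_of_real (row_weight (U * H) i) = (U * (H * H\<^sup>\<dagger>) * U\<^sup>\<dagger>) $$ (i, i)"
    using i by (simp flip: gram_diag_eq_row_weight[OF UH] gram_mult_isometry(1)[OF U H])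
  also have "\<dots> = (\<Sum>j<n. (U * (H * H\<^sup>\<dagger>)) $$ (i, j) * U\<^sup>\<dagger> $$ (j, i))"
    using U HH i by (intro index_mult_mat_sum[of _ n n _ n]) auto
  also have "\<dots> = (\<Sum>j<n. complex_of_real ((cmod (U $$ (i, j)))^2 * row_weight H j))"
    unfolding of_real_mult complex_norm_square using U i
    by (intro sum.cong) (auto simp: UHH_index)
  finally show ?thesis by (simp only: of_real_sum[symmetric] of_real_eq_iff)
qed

theorem gram_entropy_le_sum_row_weight:
  assumes G: "G \<in> carrier_mat n m"
  shows "gram_entropy G \<le> (\<Sum>i<n. eta (row_weight G i))"
proof (cases "n = 0")
  case True
  with G have "diagonal_mat (G * G\<^sup>\<dagger>)" by (auto simp: diagonal_mat_def)
  then show ?thesis by (simp add: gram_entropy_diagonal[OF G])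
next
  case False
  then have nonempty: "{..<n} \<noteq> {}" by auto
  obtain U H where unitary: "unitary_mat n U" and H: "H \<in> carrier_mat n m"
    and diag: "diagonal_mat (H * H\<^sup>\<dagger>)" and G_eq: "G = U * H" and gram_eq: "G\<^sup>\<dagger> * G = H\<^sup>\<dagger> * H"
    by (rule unitary_mult_diagonal_gram[OF G])
  note U = unitary_matD[OF unitary]
  define w where "w i j = (cmod (U $$ (i, j)))^2" for i j
  have "gram_entropy G = (\<Sum>j<n. eta (row_weight H j))"
    unfolding gram_entropy_cong[OF G H gram_eq] by (rule gram_entropy_diagonal[OF H diag])
  also have "\<dots> = (\<Sum>j<n. (\<Sum>i<n. w i j) * eta (row_weight H j))"
    using unitary_mat_doubly_stochastic(2)[OF unitary] by (simp add: w_def)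
  also have "\<dots> = (\<Sum>i<n. \<Sum>j<n. w i j * eta (row_weight H j))"
    unfolding sum_distrib_right by (rule sum.swap)
  also have "\<dots> \<le> (\<Sum>i<n. eta (\<Sum>j<n. w i j * row_weight H j))"
  proof (rule sum_mono)
    fix i assume "i \<in> {..<n}"
    then have "(\<Sum>j<n. w i j) = 1"
      using unitary_mat_doubly_stochastic(1)[OF unitary] by (simp add: w_def)
    then show "(\<Sum>j<n. w i j * eta (row_weight H j)) \<le> eta (\<Sum>j<n. w i j * row_weight H j)"
      using concave_on_sum[OF finite_lessThan nonempty concave_on_eta, of "w i" "row_weight H"]
      by (simp add: w_def row_weight_nonneg)
  qed
  also have "\<dots> = (\<Sum>i<n. eta (row_weight G i))"
    unfolding G_eq w_def by (simp add: row_weight_unitary_mult[OF U(1) H diag])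
  finally show ?thesis .
qed

lemma sum_lessThan_add:
  fixes f :: "nat \<Rightarrow> 'a :: comm_monoid_add"
  shows "(\<Sum>i<n + m. f i) = (\<Sum>i<n. f i) + (\<Sum>i<m. f (n + i))"
  by (induction m) (auto simp: add.assoc)

lemma adjoint_append_rows_mult:
  fixes A B :: "complex mat"
  assumes A: "A \<in> carrier_mat n k" and B: "B \<in> carrier_mat m k"
  shows "(A @\<^sub>r B)\<^sup>\<dagger> * (A @\<^sub>r B) = A\<^sup>\<dagger> * A + B\<^sup>\<dagger> * B"
proof (rule eq_matI)
  have AB: "A @\<^sub>r B \<in> carrier_mat (n + m) k" using A B by auto
  then show "dim_row ((A @\<^sub>r B)\<^sup>\<dagger> * (A @\<^sub>r B)) = dim_row (A\<^sup>\<dagger> * A + B\<^sup>\<dagger> * B)"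
    "dim_col ((A @\<^sub>r B)\<^sup>\<dagger> * (A @\<^sub>r B)) = dim_col (A\<^sup>\<dagger> * A + B\<^sup>\<dagger> * B)"
    using B by auto
  fix i j assume "i < dim_row (A\<^sup>\<dagger> * A + B\<^sup>\<dagger> * B)" "j < dim_col (A\<^sup>\<dagger> * A + B\<^sup>\<dagger> * B)"
  then have ij: "i < k" "j < k" using A B by auto
  have "((A @\<^sub>r B)\<^sup>\<dagger> * (A @\<^sub>r B)) $$ (i, j) = (A\<^sup>\<dagger> * A) $$ (i, j) + (B\<^sup>\<dagger> * B) $$ (i, j)"
    unfolding index_adjoint_mult_self[OF AB ij] index_adjoint_mult_self[OF A ij]
      index_adjoint_mult_self[OF B ij] sum_lessThan_add
    using A B ij by (intro arg_cong2[where f = "(+)"] sum.cong) (auto simp: append_rows_def)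
  then show "((A @\<^sub>r B)\<^sup>\<dagger> * (A @\<^sub>r B)) $$ (i, j) = (A\<^sup>\<dagger> * A + B\<^sup>\<dagger> * B) $$ (i, j)"
    using A B ij by (simp del: index_mult_mat(1))
qed

lemma sum_row_weight_append_rows:
  assumes A: "A \<in> carrier_mat n k" and B: "B \<in> carrier_mat m k"
  shows "(\<Sum>i<n + m. f (row_weight (A @\<^sub>r B) i))
    = (\<Sum>i<n. f (row_weight A i)) + (\<Sum>i<m. f (row_weight B i))"
proof -
  have "row_weight (A @\<^sub>r B) i = row_weight A i" if "i < n" for i
    using A B that carrier_append_rows[OF A B] by (auto simp: row_weight_def append_rows_def)
  moreover have "row_weight (A @\<^sub>r B) (n + i) = row_weight B i" if "i < m" for i
    using A B that carrier_append_rows[OF A B] by (auto simp: row_weight_def append_rows_def)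
  ultimately show ?thesis
    by (simp add: sum_lessThan_add)
qed

theorem gram_entropy_append_rows_le:
  assumes A: "A \<in> carrier_mat n k" and B: "B \<in> carrier_mat m k"
  shows "gram_entropy (A @\<^sub>r B) \<le> gram_entropy A + gram_entropy B"
proof -
  obtain U A' where A': "A' \<in> carrier_mat n k" "diagonal_mat (A' * A'\<^sup>\<dagger>)" "A\<^sup>\<dagger> * A = A'\<^sup>\<dagger> * A'"
    by (rule unitary_mult_diagonal_gram[OF A])
  obtain V B' where B': "B' \<in> carrier_mat m k" "diagonal_mat (B' * B'\<^sup>\<dagger>)" "B\<^sup>\<dagger> * B = B'\<^sup>\<dagger> * B'"
    by (rule unitary_mult_diagonal_gram[OF B])
  note AB = carrier_append_rows[OF A B] and A'B' = carrier_append_rows[OF A'(1) B'(1)]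
  have "(A @\<^sub>r B)\<^sup>\<dagger> * (A @\<^sub>r B) = (A' @\<^sub>r B')\<^sup>\<dagger> * (A' @\<^sub>r B')"
    unfolding adjoint_append_rows_mult[OF A B] adjoint_append_rows_mult[OF A'(1) B'(1)] A'(3) B'(3)
    ..
  then have "gram_entropy (A @\<^sub>r B) = gram_entropy (A' @\<^sub>r B')"
    by (rule gram_entropy_cong[OF AB A'B'])
  also have "\<dots> \<le> (\<Sum>i<n + m. eta (row_weight (A' @\<^sub>r B') i))"
    by (rule gram_entropy_le_sum_row_weight[OF A'B'])
  also have "\<dots> = gram_entropy A' + gram_entropy B'"
    unfolding sum_row_weight_append_rows[OF A'(1) B'(1)] gram_entropy_diagonal[OF A'(1,2)]
      gram_entropy_diagonal[OF B'(1,2)] ..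
  also have "\<dots> = gram_entropy A + gram_entropy B"
    unfolding gram_entropy_cong[OF A A'(1,3)] gram_entropy_cong[OF B B'(1,3)] ..
  finally show ?thesis .
qed

lemma vn_entropy_direct_sum_mat:
  assumes A: "A \<in> carrier_mat n n" and B: "B \<in> carrier_mat m m"
  shows "vn_entropy (direct_sum_mat A B) = vn_entropy A + vn_entropy B"
proof -
  have "char_poly (direct_sum_mat A B) = char_poly A * char_poly B"
    using char_poly_factorized[OF A] char_poly_factorized[OF B] A B
    by (intro char_poly_0_block[of _ _ "0\<^sub>m n m" m n]) (auto simp: direct_sum_mat_def)
  then show ?thesis
    unfolding vn_entropy_eq_sum_proots[OF A] vn_entropy_eq_sum_proots[OF B]
      vn_entropy_eq_sum_proots[OF direct_sum_mat_carrier[OF A B]]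
    by (simp add: proots_mult char_poly_neq_0[OF A] char_poly_neq_0[OF B])
qed

lemma gram_append_rows:
  fixes A B :: "complex mat"
  assumes A: "A \<in> carrier_mat n k" and B: "B \<in> carrier_mat m k" and orth: "A * B\<^sup>\<dagger> = 0\<^sub>m n m"
  shows "(A @\<^sub>r B) * (A @\<^sub>r B)\<^sup>\<dagger> = direct_sum_mat (A * A\<^sup>\<dagger>) (B * B\<^sup>\<dagger>)"
proof -
  have "(A * B\<^sup>\<dagger>)\<^sup>\<dagger> = B * A\<^sup>\<dagger>" using mat_adjoint_mult[OF A mat_adjoint_carrier[OF B]] by simp
  then have orth': "B * A\<^sup>\<dagger> = 0\<^sub>m m n" using orth by simp
  have adjoint: "(A @\<^sub>r B)\<^sup>\<dagger> = four_block_mat A\<^sup>\<dagger> B\<^sup>\<dagger> (0\<^sub>m 0 n) (0\<^sub>m 0 m)"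
    using A B by (intro eq_matI) (auto simp: append_rows_def)
  show ?thesis
    unfolding adjoint using A B orth orth'
    by (simp add: append_rows_def direct_sum_mat_def
        mult_four_block_mat[of _ n k _ 0 _ m _ _ n _ m])
qed

lemma gram_entropy_append_rows_orthogonal:
  assumes A: "A \<in> carrier_mat n k" and B: "B \<in> carrier_mat m k" and orth: "A * B\<^sup>\<dagger> = 0\<^sub>m n m"
  shows "gram_entropy (A @\<^sub>r B) = gram_entropy A + gram_entropy B"
proof -
  have "A * A\<^sup>\<dagger> \<in> carrier_mat n n" "B * B\<^sup>\<dagger> \<in> carrier_mat m m" using A B by auto
  then show ?thesis
    unfolding gram_entropy_def gram_append_rows[OF assms] by (rule vn_entropy_direct_sum_mat)
qed

section \<open>The partial swap gate\<close>

lemma sum_lessThan_2: "(\<Sum>i<2. h i) = h 0 + h (1::nat)"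
  by (simp add: numeral_2_eq_2)

lemma sum_div_mod:
  fixes h :: "nat \<Rightarrow> nat \<Rightarrow> 'a :: comm_monoid_add"
  assumes "0 < d"
  shows "(\<Sum>k<n * d. h (k div d) (k mod d)) = (\<Sum>a<n. \<Sum>r<d. h a r)"
proof -
  have "(\<Sum>k<n * d. h (k div d) (k mod d)) = (\<Sum>a<n. \<Sum>k = a * d..<a * d + d. h (k div d) (k mod d))"
    by (simp add: sum.nat_group)
  also have "\<dots> = (\<Sum>a<n. \<Sum>r<d. h a r)"
  proof (rule sum.cong[OF refl])
    fix a
    have "(\<Sum>k = a * d..<a * d + d. h (k div d) (k mod d))
      = (\<Sum>r = 0..<d. h ((r + a * d) div d) ((r + a * d) mod d))"
      using sum.shift_bounds_nat_ivl[of "\<lambda>k. h (k div d) (k mod d)" 0 "a * d" d]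
      by (simp add: add.commute)
    also have "\<dots> = (\<Sum>r<d. h a r)" using assms by (intro sum.cong) auto
    finally show "(\<Sum>k = a * d..<a * d + d. h (k div d) (k mod d)) = (\<Sum>r<d. h a r)" .
  qed
  finally show ?thesis .
qed

lemma mult_add_less:
  fixes a d :: nat
  assumes "a < n" "r < d"
  shows "a * d + r < n * d"
proof -
  have "a * d + r < Suc a * d" using assms by simp
  also have "\<dots> \<le> n * d" using assms by (intro mult_le_mono1) simp
  finally show ?thesis .
qed

definition tensor_id :: "complex mat \<Rightarrow> nat \<Rightarrow> complex mat" where
  "tensor_id V d = mat (dim_row V * d) (dim_col V * d)
    (\<lambda>(i, j). if i mod d = j mod d then V $$ (i div d, j div d) else 0)"

lemma tensor_id_carrier [simp]: "V \<in> carrier_mat n m \<Longrightarrow> tensor_id V d \<in> carrier_mat (n * d) (m * d)"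
  by (simp add: tensor_id_def)

lemma tensor_id_dim [simp]:
  "dim_row (tensor_id V d) = dim_row V * d" "dim_col (tensor_id V d) = dim_col V * d"
  by (simp_all add: tensor_id_def)

lemma index_tensor_id_mult:
  assumes V: "V \<in> carrier_mat n m" and X: "X \<in> carrier_mat (m * d) k"
    and i: "i < n * d" and j: "j < k"
  shows "(tensor_id V d * X) $$ (i, j) = (\<Sum>f<m. V $$ (i div d, f) * X $$ (f * d + i mod d, j))"
proof -
  have d: "0 < d" using i by (cases d) auto
  have "(tensor_id V d * X) $$ (i, j)
      = (\<Sum>l<m * d. (if l mod d = i mod d then V $$ (i div d, l div d) else 0)
          * X $$ (l div d * d + l mod d, j))"
    unfolding index_mult_mat_sum[OF tensor_id_carrier[OF V] X i j]
    using V i by (intro sum.cong) (auto simp: tensor_id_def)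
  also have "\<dots> = (\<Sum>f<m. \<Sum>r<d. (if r = i mod d then V $$ (i div d, f) else 0) * X $$ (f * d + r, j))"
    by (rule sum_div_mod[OF d])
  also have "\<dots> = (\<Sum>f<m. V $$ (i div d, f) * X $$ (f * d + i mod d, j))"
    using d by (intro sum.cong) (auto simp: if_distrib[of "\<lambda>x. x * _"] cong: if_cong)
  finally show ?thesis .
qed

lemma tensor_id_mult:
  assumes V: "V \<in> carrier_mat n m" and W: "W \<in> carrier_mat m k"
  shows "tensor_id V d * tensor_id W d = tensor_id (V * W) d"
proof (rule eq_matI)
  fix i j assume "i < dim_row (tensor_id (V * W) d)" "j < dim_col (tensor_id (V * W) d)"
  then have ij: "i < n * d" "j < k * d" using V W by (auto simp: tensor_id_def)
  then have d: "0 < d" by (cases d) auto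
  have div: "i div d < n" "j div d < k" using ij by (auto simp: less_mult_imp_div_less)
  have "(tensor_id V d * tensor_id W d) $$ (i, j)
      = (\<Sum>f<m. V $$ (i div d, f) * (if i mod d = j mod d then W $$ (f, j div d) else 0))"
    unfolding index_tensor_id_mult[OF V tensor_id_carrier[OF W] ij]
    using W ij d by (intro sum.cong) (auto simp: tensor_id_def mult_add_less)
  also have "\<dots> = tensor_id (V * W) d $$ (i, j)"
    using V W ij div by (simp add: tensor_id_def index_mult_mat_sum[OF V W] del: index_mult_mat(1))
  finally show "(tensor_id V d * tensor_id W d) $$ (i, j) = tensor_id (V * W) d $$ (i, j)" .
qed (use V W in \<open>auto simp: tensor_id_def\<close>)

lemma tensor_id_one: "tensor_id (1\<^sub>m n) d = 1\<^sub>m (n * d)"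
proof (rule eq_matI)
  fix i j assume "i < dim_row (1\<^sub>m (n * d) :: complex mat)" "j < dim_col (1\<^sub>m (n * d) :: complex mat)"
  moreover have "i = j" if "i div d = j div d" "i mod d = j mod d"
    using that by (metis div_mult_mod_eq)
  ultimately show "tensor_id (1\<^sub>m n) d $$ (i, j) = 1\<^sub>m (n * d) $$ (i, j)"
    by (auto simp: tensor_id_def less_mult_imp_div_less)
qed (auto simp: tensor_id_def)

lemma unitary_tensor_id:
  assumes "unitary_mat n V"
  shows "unitary_mat (n * d) (tensor_id V d)"
proof -
  note V = unitary_matD[OF assms]
  have "(tensor_id V d)\<^sup>\<dagger> = tensor_id V\<^sup>\<dagger> d"
    using V(1) by (intro eq_matI) (auto simp: tensor_id_def less_mult_imp_div_less)
  then have "(tensor_id V d)\<^sup>\<dagger> * tensor_id V d = 1\<^sub>m (n * d)"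
    by (simp add: tensor_id_mult[OF V(2,1)] V(3) tensor_id_one)
  then show ?thesis using V(1) by (simp add: unitary_mat_def)
qed

lemma unitary_transpose_mat:
  assumes "unitary_mat n U"
  shows "unitary_mat n U\<^sup>T"
proof -
  note U = unitary_matD[OF assms]
  have "(U\<^sup>T)\<^sup>\<dagger> = (U\<^sup>\<dagger>)\<^sup>T" by (rule eq_matI) auto
  then have "(U\<^sup>T)\<^sup>\<dagger> * U\<^sup>T = (U * U\<^sup>\<dagger>)\<^sup>T"
    by (simp add: transpose_mult[OF U(1,2)])
  then show ?thesis using U by (simp add: unitary_mat_def)
qed

definition coeff_mat :: "nat \<Rightarrow> complex vec \<Rightarrow> complex mat" where
  "coeff_mat d v = mat 2 d (\<lambda>(a, r). v $ (a * d + r))"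

lemma coeff_mat_carrier [simp]: "coeff_mat d v \<in> carrier_mat 2 d"
  by (simp add: coeff_mat_def)

definition swap_amp :: "real \<Rightarrow> complex mat \<Rightarrow> complex mat \<Rightarrow> nat \<Rightarrow> nat \<Rightarrow> nat \<Rightarrow> nat \<Rightarrow> complex" where
  "swap_amp \<theta> \<Phi> \<Psi> a r b s =
    complex_of_real (cos \<theta>) * \<Phi> $$ (a, r) * \<Psi> $$ (b, s)
    + \<i> * complex_of_real (sin \<theta>) * \<Phi> $$ (b, r) * \<Psi> $$ (a, s)"

definition swap_output :: "real \<Rightarrow> complex mat \<Rightarrow> complex mat \<Rightarrow> complex mat" where
  "swap_output \<theta> \<Phi> \<Psi> = mat (2 * dim_col \<Psi>) (2 * dim_col \<Phi>) (\<lambda>(i, k).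
    swap_amp \<theta> \<Phi> \<Psi> (k div dim_col \<Phi>) (k mod dim_col \<Phi>) (i div dim_col \<Psi>) (i mod dim_col \<Psi>))"

lemma swap_output_carrier:
  "\<Phi> \<in> carrier_mat 2 d \<Longrightarrow> \<Psi> \<in> carrier_mat 2 e \<Longrightarrow> swap_output \<theta> \<Phi> \<Psi> \<in> carrier_mat (2 * e) (2 * d)"
  by (simp add: swap_output_def)

lemma Ugate_index:
  assumes "a < 2" "b < 2" "a' < 2" "b' < 2"
  shows "Ugate x $$ (2 * a + b, 2 * a' + b') = exp (- \<i> * complex_of_real x) *
    (complex_of_real (cos (2 * x)) * (if a = a' \<and> b = b' then 1 else 0)
     + \<i> * complex_of_real (sin (2 * x)) * (if a = b' \<and> b = a' then 1 else 0))"
proof -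
  define \<omega> where "\<omega> = exp (- \<i> * complex_of_real x)"
  define \<alpha> where "\<alpha> = complex_of_real ((cos x)^3) + \<i> * complex_of_real ((sin x)^3)"
  define \<beta> where "\<beta> = \<i> * complex_of_real (sin x * cos x) * \<omega>"
  have "\<omega> = Complex (cos x) (- sin x)"
    by (simp add: \<omega>_def exp_eq_polar complex_eq_iff)
  then have antiparallel: "\<alpha> - \<beta> = \<omega> * complex_of_real (cos (2 * x))"
    unfolding \<alpha>_def \<beta>_def cos_double
    by (simp add: complex_eq_iff power2_eq_square power3_eq_cube algebra_simps)
  have exchange: "2 * \<beta> = \<omega> * (\<i> * complex_of_real (sin (2 * x)))"
    by (simp add: \<beta>_def sin_double)
  have parallel: "\<alpha> + \<beta> = \<omega> * (complex_of_real (cos (2 * x)) + \<i> * complex_of_real (sin (2 * x)))"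
    using antiparallel exchange by (simp add: algebra_simps)
  have cases: "a = 0 \<or> a = 1" "b = 0 \<or> b = 1" "a' = 0 \<or> a' = 1" "b' = 0 \<or> b' = 1"
    using assms by auto
  then have "Ugate x $$ (2 * a + b, 2 * a' + b') =
    (if a = a' \<and> b = b' then (if a = b then \<alpha> + \<beta> else \<alpha> - \<beta>)
     else if a = b' \<and> b = a' then 2 * \<beta> else 0)"
    unfolding Ugate_def \<omega>_def[symmetric] \<alpha>_def[symmetric] \<beta>_def[symmetric]
    by (elim disjE) (simp_all add: kron2_def pauli_def mat_of_rows_list_def)
  with cases show ?thesis
    unfolding antiparallel exchange parallel \<omega>_def by (elim disjE) simp_all
qed

lemma out_amp_Ugate:
  assumes "a < 2" "b < 2" "r < dA" "s < dB"
  shows "out_amp (Ugate x) dA dB phi psi a r b s = exp (- \<i> * complex_of_real x)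
    * swap_amp (2 * x) (coeff_mat dA phi) (coeff_mat dB psi) a r b s"
proof -
  have "out_amp (Ugate x) dA dB phi psi a r b s = (\<Sum>a'<2. \<Sum>b'<2. exp (- \<i> * complex_of_real x)
    * (complex_of_real (cos (2 * x)) * (if a = a' \<and> b = b' then 1 else 0)
      + \<i> * complex_of_real (sin (2 * x)) * (if a = b' \<and> b = a' then 1 else 0))
    * phi $ (a' * dA + r) * psi $ (b' * dB + s))"
    unfolding out_amp_def using assms by (intro sum.cong) (auto simp: Ugate_index)
  then show ?thesis
    using assms
    by (auto simp: less_2_cases_iff sum_lessThan_2 swap_amp_def coeff_mat_def algebra_simps)
qed

lemma reduced_BR_Ugate:
  fixes x :: real and phi psi :: "complex vec" and dA dB :: nat
  assumes dA: "0 < dA"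
  defines "Y \<equiv> swap_output (2 * x) (coeff_mat dA phi) (coeff_mat dB psi)"
  shows "reduced_BR (Ugate x) dA dB phi psi = Y * Y\<^sup>\<dagger>"
proof (rule eq_matI)
  define \<omega> where "\<omega> = exp (- \<i> * complex_of_real x)"
  have phase: "(\<omega> * z) * cnj (\<omega> * w) = z * cnj w" for z w
  proof -
    have "\<omega> * cnj \<omega> = 1"
      by (simp add: \<omega>_def exp_eq_polar complex_eq_iff flip: power2_eq_square)
    then show ?thesis by (metis complex_cnj_mult mult.commute mult.left_commute mult_1)
  qed
  have Y: "Y \<in> carrier_mat (2 * dB) (2 * dA)"
    unfolding Y_def by (intro swap_output_carrier) auto
  fix i j assume "i < dim_row (Y * Y\<^sup>\<dagger>)" "j < dim_col (Y * Y\<^sup>\<dagger>)"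
  then have ij: "i < 2 * dB" "j < 2 * dB" using Y by auto
  then have i: "i div dB < 2" "i mod dB < dB" and j: "j div dB < 2" "j mod dB < dB"
    by (auto simp: less_mult_imp_div_less intro: mod_less_divisor gr0I)
  define amp where "amp a r i
    = swap_amp (2 * x) (coeff_mat dA phi) (coeff_mat dB psi) a r (i div dB) (i mod dB)" for a r i
  have "out_amp (Ugate x) dA dB phi psi a r (i div dB) (i mod dB)
      * cnj (out_amp (Ugate x) dA dB phi psi a r (j div dB) (j mod dB))
      = amp a r i * cnj (amp a r j)"
    if "a < 2" "r < dA" for a r
    unfolding out_amp_Ugate[OF that(1) i(1) that(2) i(2)]
      out_amp_Ugate[OF that(1) j(1) that(2) j(2)]
      \<omega>_def[symmetric] amp_def by (rule phase)
  then have "reduced_BR (Ugate x) dA dB phi psi $$ (i, j)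
      = (\<Sum>a<2. \<Sum>r<dA. amp a r i * cnj (amp a r j))"
    using ij by (simp add: reduced_BR_def)
  also have "\<dots> = (\<Sum>k<2 * dA. amp (k div dA) (k mod dA) i * cnj (amp (k div dA) (k mod dA) j))"
    by (rule sum_div_mod[OF dA, symmetric])
  also have "\<dots> = (Y * Y\<^sup>\<dagger>) $$ (i, j)"
    unfolding index_gram[OF Y ij] using ij
    by (intro sum.cong) (auto simp: Y_def amp_def swap_output_def coeff_mat_def)
  finally show "reduced_BR (Ugate x) dA dB phi psi $$ (i, j) = (Y * Y\<^sup>\<dagger>) $$ (i, j)" .
qed (auto simp: Y_def reduced_BR_def swap_output_def coeff_mat_def)

lemma ent_out_Ugate:
  assumes "0 < dA"
  shows "ent_out (Ugate x) dA dB phi psi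
    = gram_entropy (swap_output (2 * x) (coeff_mat dA phi) (coeff_mat dB psi))"
  by (simp add: ent_out_def gram_entropy_def reduced_BR_Ugate[OF assms])

lemma index_mult_transpose_tensor_id:
  assumes V: "V \<in> carrier_mat n m" and X: "X \<in> carrier_mat k (m * d)"
    and i: "i < k" and j: "j < n * d"
  shows "(X * (tensor_id V d)\<^sup>T) $$ (i, j) = (\<Sum>a<m. V $$ (j div d, a) * X $$ (i, a * d + j mod d))"
proof -
  have d: "0 < d" using j by (cases d) auto
  have "(X * (tensor_id V d)\<^sup>T) $$ (i, j) = (X * (tensor_id V d)\<^sup>T)\<^sup>T $$ (j, i)"
    using V X i j by simp
  also have "(X * (tensor_id V d)\<^sup>T)\<^sup>T = tensor_id V d * X\<^sup>T"
    using transpose_mult[OF X, of "(tensor_id V d)\<^sup>T" "n * d"] tensor_id_carrier[OF V, of d] by simp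
  also have "\<dots> $$ (j, i) = (\<Sum>a<m. V $$ (j div d, a) * X\<^sup>T $$ (a * d + j mod d, i))"
    using X i by (intro index_tensor_id_mult[OF V _ j]) auto
  also have "\<dots> = (\<Sum>a<m. V $$ (j div d, a) * X $$ (i, a * d + j mod d))"
    using X i d by (intro sum.cong) (auto simp: mult_add_less)
  finally show ?thesis .
qed

lemma swap_output_local_unitary:
  assumes V: "V \<in> carrier_mat 2 2" and \<Phi>: "\<Phi> \<in> carrier_mat 2 d" and \<Psi>: "\<Psi> \<in> carrier_mat 2 e"
  shows "swap_output \<theta> (V * \<Phi>) (V * \<Psi>) = tensor_id V e * swap_output \<theta> \<Phi> \<Psi> * (tensor_id V d)\<^sup>T"
    (is "?Y' = tensor_id V e * ?Y * (tensor_id V d)\<^sup>T")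
proof (rule eq_matI)
  note Y = swap_output_carrier[OF \<Phi> \<Psi>, of \<theta>]
  have KY: "tensor_id V e * ?Y \<in> carrier_mat (2 * e) (2 * d)"
    using tensor_id_carrier[OF V, of e] Y by (rule mult_carrier_mat)
  fix i k assume "i < dim_row (tensor_id V e * ?Y * (tensor_id V d)\<^sup>T)"
    "k < dim_col (tensor_id V e * ?Y * (tensor_id V d)\<^sup>T)"
  then have ik: "i < 2 * e" "k < 2 * d" using V by auto
  then have i: "i div e < 2" "i mod e < e" and k: "k div d < 2" "k mod d < d"
    by (auto simp: less_mult_imp_div_less intro: mod_less_divisor gr0I)
  have index_V_mult: "(V * X) $$ (b, r) = V $$ (b, 0) * X $$ (0, r) + V $$ (b, 1) * X $$ (1, r)"
    if "X \<in> carrier_mat 2 n" "b < 2" "r < n" for X n b r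
    unfolding index_mult_mat_sum[OF V that(1,2,3)] sum_lessThan_2 ..
  have "(tensor_id V e * ?Y * (tensor_id V d)\<^sup>T) $$ (i, k)
      = (\<Sum>a<2. V $$ (k div d, a) * (tensor_id V e * ?Y) $$ (i, a * d + k mod d))"
    by (rule index_mult_transpose_tensor_id[OF V KY ik])
  also have "\<dots> = (\<Sum>a<2. V $$ (k div d, a)
      * (\<Sum>b<2. V $$ (i div e, b) * swap_amp \<theta> \<Phi> \<Psi> a (k mod d) b (i mod e)))"
    using ik i k mult_add_less[OF _ k(2), of _ 2] mult_add_less[OF _ i(2), of _ 2] \<Phi> \<Psi>
    by (intro sum.cong arg_cong2[where f = "(*)"] refl, subst index_tensor_id_mult[OF V Y])
      (auto simp: swap_output_def intro!: sum.cong)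
  also have "\<dots> = ?Y' $$ (i, k)"
    using ik i k \<Phi> \<Psi>
    by (simp add: swap_output_def swap_amp_def index_V_mult[OF \<Phi>] index_V_mult[OF \<Psi>] sum_lessThan_2
        del: index_mult_mat(1))
      (simp add: algebra_simps)
  finally show "?Y' $$ (i, k) = (tensor_id V e * ?Y * (tensor_id V d)\<^sup>T) $$ (i, k)" ..
qed (use assms in \<open>auto simp: swap_output_def\<close>)

lemma gram_entropy_swap_output_local_unitary:
  assumes V: "unitary_mat 2 V" and \<Phi>: "\<Phi> \<in> carrier_mat 2 d" and \<Psi>: "\<Psi> \<in> carrier_mat 2 e"
  shows "gram_entropy (swap_output \<theta> (V * \<Phi>) (V * \<Psi>)) = gram_entropy (swap_output \<theta> \<Phi> \<Psi>)"
  unfolding swap_output_local_unitary[OF unitary_matD(1)[OF V] \<Phi> \<Psi>]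
  by (intro gram_entropy_unitary_mult[of "2 * e" _ "2 * d"] unitary_tensor_id unitary_transpose_mat
      V swap_output_carrier \<Phi> \<Psi>)

text \<open>
  Both sectors have one row for each of the two Schmidt vectors \<open>|s\<rangle>\<close> of \<open>\<Psi>\<close> in \<open>R\<^sub>B\<close>: the neutral
  one collects the output \<open>|b s\<rangle>\<close> with \<open>b = s\<close>, the flipped one the output with \<open>b \<noteq> s\<close>.
\<close>

locale diagonal_swap_input =
  fixes \<theta> :: real and \<Phi> \<Psi> :: "complex mat" and d e :: nat
  assumes \<Phi>: "\<Phi> \<in> carrier_mat 2 d" and \<Psi>: "\<Psi> \<in> carrier_mat 2 e"
    and \<Psi>_diagonal: "diagonal_mat (\<Psi> * \<Psi>\<^sup>\<dagger>)"
    and \<Phi>_norm: "row_weight \<Phi> 0 + row_weight \<Phi> 1 = 1"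
    and \<Psi>_norm: "row_weight \<Psi> 0 + row_weight \<Psi> 1 = 1"
begin

abbreviation c where "c \<equiv> complex_of_real (cos \<theta>)"
abbreviation s where "s \<equiv> complex_of_real (sin \<theta>)"
abbreviation p where "p \<equiv> row_weight \<Phi>"
abbreviation q where "q \<equiv> row_weight \<Psi>"

definition sqrt_q :: "nat \<Rightarrow> complex" where
  "sqrt_q b = complex_of_real (sqrt (q b))"

definition neutral_phase :: "nat \<Rightarrow> nat \<Rightarrow> complex" where
  "neutral_phase b a = c + (if a = b then \<i> * s else 0)"

definition neutral_sector :: "complex mat" where
  "neutral_sector = mat 2 (2 * d) (\<lambda>(b, k).
    sqrt_q b * neutral_phase b (k div d) * \<Phi> $$ (k div d, k mod d))"

definition flipped_sector :: "complex mat" where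
  "flipped_sector = mat 2 (2 * d) (\<lambda>(b, k).
    if k div d = b then sqrt_q b * (\<i> * s) * \<Phi> $$ (1 - b, k mod d) else 0)"

lemma neutral_sector_carrier: "neutral_sector \<in> carrier_mat 2 (2 * d)"
  by (simp add: neutral_sector_def)

lemma flipped_sector_carrier: "flipped_sector \<in> carrier_mat 2 (2 * d)"
  by (simp add: flipped_sector_def)

lemma dims_pos: "0 < d" "0 < e"
  using \<Phi> \<Psi> \<Phi>_norm \<Psi>_norm by (auto simp: row_weight_def intro!: gr0I)

lemma complement: "p 1 = 1 - p 0" "q 1 = 1 - q 0"
  using \<Phi>_norm \<Psi>_norm by simp_all

lemma sqrt_q_mult_self: "sqrt_q b * sqrt_q b = complex_of_real (q b)"
  by (simp add: sqrt_q_def flip: of_real_mult)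

lemma sqrt_q_mult_self_left: "sqrt_q b * (sqrt_q b * z) = complex_of_real (q b) * z"
  by (simp add: sqrt_q_mult_self flip: mult.assoc)

lemma cnj_sqrt_q [simp]: "cnj (sqrt_q b) = sqrt_q b"
  by (simp add: sqrt_q_def)

lemma neutral_phase_distinct: "a \<noteq> b \<Longrightarrow> neutral_phase b a = c"
  by (simp add: neutral_phase_def)

lemma neutral_phase_mult_cnj: "neutral_phase b b * cnj (neutral_phase b b) = 1"
  by (simp add: neutral_phase_def complex_eq_iff flip: power2_eq_square)

lemma \<Psi>_orthogonal:
  assumes "a < 2" "b < 2"
  shows "(\<Sum>j<e. cnj (\<Psi> $$ (a, j)) * \<Psi> $$ (b, j)) = (if a = b then complex_of_real (q a) else 0)"
proof -
  have "(\<Sum>j<e. cnj (\<Psi> $$ (a, j)) * \<Psi> $$ (b, j)) = (\<Psi> * \<Psi>\<^sup>\<dagger>) $$ (b, a)"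
    unfolding index_gram[OF \<Psi> assms(2,1)] by (simp add: mult.commute)
  also have "\<dots> = (if a = b then complex_of_real (q a) else 0)"
    using \<Psi>_diagonal \<Psi> assms
    by (simp add: gram_diag_eq_row_weight[OF \<Psi>] diagonal_mat_def del: index_mult_mat(1))
  finally show ?thesis .
qed

lemma sum_cnj_swap_amp_mult:
  assumes a: "a < 2" "a' < 2"
  shows "(\<Sum>b<2. \<Sum>j<e. cnj (swap_amp \<theta> \<Phi> \<Psi> a r b j) * swap_amp \<theta> \<Phi> \<Psi> a' r' b j)
    = (\<Sum>b<2. c * c * (cnj (\<Phi> $$ (a, r)) * \<Phi> $$ (a', r')) * q b
        + \<i> * c * s * (cnj (\<Phi> $$ (a, r)) * \<Phi> $$ (b, r')) * (if b = a' then q b else 0)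
        - \<i> * c * s * (cnj (\<Phi> $$ (b, r)) * \<Phi> $$ (a', r')) * (if a = b then q a else 0)
        + s * s * (cnj (\<Phi> $$ (b, r)) * \<Phi> $$ (b, r')) * (if a = a' then q a else 0))"
proof (rule sum.cong[OF refl])
  fix b :: nat assume "b \<in> {..<2}"
  define G where "G b b' = (\<Sum>j<e. cnj (\<Psi> $$ (b, j)) * \<Psi> $$ (b', j))" for b b'
  have "(\<Sum>j<e. cnj (swap_amp \<theta> \<Phi> \<Psi> a r b j) * swap_amp \<theta> \<Phi> \<Psi> a' r' b j)
      = c * c * (cnj (\<Phi> $$ (a, r)) * \<Phi> $$ (a', r')) * G b b
      + \<i> * c * s * (cnj (\<Phi> $$ (a, r)) * \<Phi> $$ (b, r')) * G b a'
      - \<i> * c * s * (cnj (\<Phi> $$ (b, r)) * \<Phi> $$ (a', r')) * G a b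
      + s * s * (cnj (\<Phi> $$ (b, r)) * \<Phi> $$ (b, r')) * G a a'"
    unfolding G_def sum_distrib_left sum.distrib[symmetric] sum_subtractf[symmetric]
    by (intro sum.cong) (auto simp: swap_amp_def algebra_simps)
  with a \<open>b \<in> {..<2}\<close>
  show "(\<Sum>j<e. cnj (swap_amp \<theta> \<Phi> \<Psi> a r b j) * swap_amp \<theta> \<Phi> \<Psi> a' r' b j)
      = c * c * (cnj (\<Phi> $$ (a, r)) * \<Phi> $$ (a', r')) * q b
      + \<i> * c * s * (cnj (\<Phi> $$ (a, r)) * \<Phi> $$ (b, r')) * (if b = a' then q b else 0)
      - \<i> * c * s * (cnj (\<Phi> $$ (b, r)) * \<Phi> $$ (a', r')) * (if a = b then q a else 0)
      + s * s * (cnj (\<Phi> $$ (b, r)) * \<Phi> $$ (b, r')) * (if a = a' then q a else 0)"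
    by (simp add: G_def \<Psi>_orthogonal)
qed

lemma adjoint_mult_swap_output:
  "(swap_output \<theta> \<Phi> \<Psi>)\<^sup>\<dagger> * swap_output \<theta> \<Phi> \<Psi>
    = neutral_sector\<^sup>\<dagger> * neutral_sector + flipped_sector\<^sup>\<dagger> * flipped_sector" (is "?Y\<^sup>\<dagger> * ?Y = ?R")
proof (rule eq_matI)
  note Y = swap_output_carrier[OF \<Phi> \<Psi>, of \<theta>]
    and N = neutral_sector_carrier and F = flipped_sector_carrier
  fix k k' assume "k < dim_row ?R" "k' < dim_col ?R"
  then have kk': "k < 2 * d" "k' < 2 * d" using F by auto
  define a r a' r' where "a = k div d" and "r = k mod d" and "a' = k' div d" and "r' = k' mod d"
  have a: "a < 2" "a' < 2" using kk' by (auto simp: a_def a'_def less_mult_imp_div_less)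
  have "(?Y\<^sup>\<dagger> * ?Y) $$ (k, k') = (\<Sum>i<2 * e. cnj (swap_amp \<theta> \<Phi> \<Psi> a r (i div e) (i mod e))
      * swap_amp \<theta> \<Phi> \<Psi> a' r' (i div e) (i mod e))"
    unfolding index_adjoint_mult_self[OF Y kk'] using kk' \<Phi> \<Psi>
    by (intro sum.cong) (auto simp: swap_output_def a_def r_def a'_def r'_def)
  also have "\<dots> = (\<Sum>b<2. \<Sum>j<e. cnj (swap_amp \<theta> \<Phi> \<Psi> a r b j) * swap_amp \<theta> \<Phi> \<Psi> a' r' b j)"
    by (rule sum_div_mod[OF dims_pos(2)])
  also have "\<dots> = (\<Sum>b<2. cnj (neutral_sector $$ (b, k)) * neutral_sector $$ (b, k'))
      + (\<Sum>b<2. cnj (flipped_sector $$ (b, k)) * flipped_sector $$ (b, k'))"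
    unfolding sum_cnj_swap_amp_mult[OF a] using a kk' unfolding less_2_cases_iff
    by (elim disjE)
      (simp_all add: sum_lessThan_2 neutral_sector_def neutral_phase_def flipped_sector_def
        sqrt_q_mult_self sqrt_q_mult_self_left algebra_simps flip: a_def r_def a'_def r'_def)
  also have "\<dots> = ?R $$ (k, k')"
    unfolding index_adjoint_mult_self[OF N kk', symmetric]
      index_adjoint_mult_self[OF F kk', symmetric]
    using N F kk' by (simp del: index_mult_mat(1))
  finally show "(?Y\<^sup>\<dagger> * ?Y) $$ (k, k') = ?R $$ (k, k')" .
qed (use \<Phi> in \<open>auto simp: swap_output_def neutral_sector_def flipped_sector_def\<close>)

lemma gram_entropy_swap_output:
  "gram_entropy (swap_output \<theta> \<Phi> \<Psi>) = gram_entropy (neutral_sector @\<^sub>r flipped_sector)"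
proof (rule gram_entropy_cong)
  note N = neutral_sector_carrier and F = flipped_sector_carrier
  show "swap_output \<theta> \<Phi> \<Psi> \<in> carrier_mat (2 * e) (2 * d)" by (rule swap_output_carrier[OF \<Phi> \<Psi>])
  show "neutral_sector @\<^sub>r flipped_sector \<in> carrier_mat (2 + 2) (2 * d)"
    by (rule carrier_append_rows[OF N F])
  show "(swap_output \<theta> \<Phi> \<Psi>)\<^sup>\<dagger> * swap_output \<theta> \<Phi> \<Psi>
      = (neutral_sector @\<^sub>r flipped_sector)\<^sup>\<dagger> * (neutral_sector @\<^sub>r flipped_sector)"
    unfolding adjoint_append_rows_mult[OF N F] by (rule adjoint_mult_swap_output)
qed

lemma index_gram_neutral_sector:
  assumes b: "b < 2" "b' < 2"
  shows "(neutral_sector * neutral_sector\<^sup>\<dagger>) $$ (b, b')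
    = sqrt_q b * sqrt_q b' * (\<Sum>a<2. neutral_phase b a * cnj (neutral_phase b' a) * p a)"
proof -
  define z where "z a = sqrt_q b * sqrt_q b' * (neutral_phase b a * cnj (neutral_phase b' a))" for a
  have "(neutral_sector * neutral_sector\<^sup>\<dagger>) $$ (b, b')
      = (\<Sum>k<2 * d. z (k div d) * (\<Phi> $$ (k div d, k mod d) * cnj (\<Phi> $$ (k div d, k mod d))))"
    unfolding index_gram[OF neutral_sector_carrier b] using b
    by (intro sum.cong) (auto simp: neutral_sector_def z_def)
  also have "\<dots> = (\<Sum>a<2. \<Sum>r<d. z a * (\<Phi> $$ (a, r) * cnj (\<Phi> $$ (a, r))))"
    by (rule sum_div_mod[OF dims_pos(1)])
  also have "\<dots> = (\<Sum>a<2. z a * p a)"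
    by (simp only: sum_distrib_left of_real_row_weight[OF \<Phi>])
  finally show ?thesis by (simp only: z_def sum_distrib_left mult.assoc)
qed

definition neutral_diag :: "nat \<Rightarrow> real" where
  "neutral_diag b = q b * (p b + (cos \<theta>)^2 * p (1 - b))"

definition neutral_coherence :: real where
  "neutral_coherence
    = q 0 * q 1 * ((cos \<theta>)^2 * ((cos \<theta>)^2 * (p 0 + p 1)^2 + (sin \<theta>)^2 * (p 0 - p 1)^2))"

lemma neutral_sector_entries:
  shows "(neutral_sector * neutral_sector\<^sup>\<dagger>) $$ (0, 0) = complex_of_real (neutral_diag 0)"
    and "(neutral_sector * neutral_sector\<^sup>\<dagger>) $$ (1, 1) = complex_of_real (neutral_diag 1)"
    and "(neutral_sector * neutral_sector\<^sup>\<dagger>) $$ (0, 1)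
        * (neutral_sector * neutral_sector\<^sup>\<dagger>) $$ (1, 0) = complex_of_real neutral_coherence"
proof -
  let ?M = "neutral_sector * neutral_sector\<^sup>\<dagger>"
  show "?M $$ (0, 0) = complex_of_real (neutral_diag 0)"
    "?M $$ (1, 1) = complex_of_real (neutral_diag 1)"
    by (simp_all add: index_gram_neutral_sector sum_lessThan_2 sqrt_q_mult_self
        neutral_phase_mult_cnj neutral_phase_distinct neutral_diag_def power2_eq_square add.commute)
  have "?M $$ (0, 1) * ?M $$ (1, 0) = (sqrt_q 0 * sqrt_q 0) * (sqrt_q 1 * sqrt_q 1)
    * (c * c * (c * c * (complex_of_real (p 0) + p 1)^2 + s * s * (complex_of_real (p 0) - p 1)^2))"
    by (simp add: index_gram_neutral_sector sum_lessThan_2 neutral_phase_def power2_eq_square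
        algebra_simps)
  then show "?M $$ (0, 1) * ?M $$ (1, 0) = complex_of_real neutral_coherence"
    unfolding sqrt_q_mult_self by (simp add: neutral_coherence_def power2_eq_square)
qed

definition is_neutral_spectrum :: "real \<Rightarrow> real \<Rightarrow> bool" where
  "is_neutral_spectrum l m \<longleftrightarrow> l + m = neutral_diag 0 + neutral_diag 1
    \<and> l * m = neutral_diag 0 * neutral_diag 1 - neutral_coherence"

lemma neutral_trace: "neutral_diag 0 + neutral_diag 1 = 1 - (sin \<theta>)^2 * (p 0 * q 1 + p 1 * q 0)"
  unfolding neutral_diag_def diff_zero diff_self_eq_0 complement
  by (simp add: cos_squared_eq algebra_simps)

lemma neutral_det:
  "neutral_diag 0 * neutral_diag 1 - neutral_coherence
    = (sin \<theta>)^2 * (4 - 3 * (sin \<theta>)^2) * (p 0 * q 1 * (p 1 * q 0))"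
proof -
  define S where "S = (sin \<theta>)^2"
  have C: "(cos \<theta>)^2 = 1 - S" unfolding S_def by (rule cos_squared_eq)
  show ?thesis
    unfolding neutral_diag_def neutral_coherence_def diff_zero diff_self_eq_0 complement C
      S_def[symmetric]
    by (simp add: power2_eq_square algebra_simps)
qed

lemma gram_entropy_neutral_sector:
  assumes "is_neutral_spectrum l m"
  shows "gram_entropy neutral_sector = eta l + eta m"
  unfolding gram_entropy_def
proof (rule vn_entropy_2x2)
  show "neutral_sector * neutral_sector\<^sup>\<dagger> \<in> carrier_mat 2 2"
    using neutral_sector_carrier by auto
qed (use assms in \<open>simp_all only: neutral_sector_entries is_neutral_spectrum_def
  flip: of_real_add of_real_mult of_real_diff\<close>)

lemma neutral_spectrum_exists:
  obtains l m where "0 \<le> m" "m \<le> l" "is_neutral_spectrum l m"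
proof (rule nonneg_pair_with_sum_prod)
  show "0 \<le> neutral_diag 0 + neutral_diag 1"
    by (simp add: neutral_diag_def)
  have "(sin \<theta>)^2 \<le> 1" by (simp add: abs_square_le_1)
  then show "0 \<le> neutral_diag 0 * neutral_diag 1 - neutral_coherence"
    unfolding neutral_det by (intro mult_nonneg_nonneg) auto
  have "0 \<le> (neutral_diag 0 - neutral_diag 1)^2 + 4 * neutral_coherence"
    by (simp add: neutral_coherence_def)
  then show "4 * (neutral_diag 0 * neutral_diag 1 - neutral_coherence)
      \<le> (neutral_diag 0 + neutral_diag 1)^2"
    by (simp add: power2_eq_square algebra_simps)
qed (auto simp: is_neutral_spectrum_def intro: that)

lemma index_gram_flipped_sector:
  assumes b: "b < 2" "b' < 2"
  shows "(flipped_sector * flipped_sector\<^sup>\<dagger>) $$ (b, b')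
    = (if b = b' then complex_of_real ((sin \<theta>)^2 * (p (1 - b) * q b)) else 0)"
proof -
  define z where "z = (if b = b' then s * s * q b else 0)"
  have "(flipped_sector * flipped_sector\<^sup>\<dagger>) $$ (b, b') = (\<Sum>k<2 * d. if k div d = b then
      z * (\<Phi> $$ (1 - b, k mod d) * cnj (\<Phi> $$ (1 - b, k mod d))) else 0)"
    unfolding index_gram[OF flipped_sector_carrier b] using b
    by (intro sum.cong)
      (auto simp: z_def flipped_sector_def algebra_simps sqrt_q_mult_self sqrt_q_mult_self_left)
  also have "\<dots> = (\<Sum>a<2. \<Sum>r<d. if a = b then
      z * (\<Phi> $$ (1 - b, r) * cnj (\<Phi> $$ (1 - b, r))) else 0)"
    by (rule sum_div_mod[OF dims_pos(1)])
  also have "\<dots> = z * p (1 - b)"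
    using b(1) unfolding less_2_cases_iff of_real_row_weight[OF \<Phi>] sum_distrib_left
    by (elim disjE) (simp_all add: sum_lessThan_2)
  finally show ?thesis by (simp add: z_def power2_eq_square)
qed

lemma gram_entropy_flipped_sector:
  "gram_entropy flipped_sector
    = eta ((sin \<theta>)^2 * (p 0 * q 1)) + eta ((sin \<theta>)^2 * (p 1 * q 0))"
proof -
  have carrier: "flipped_sector * flipped_sector\<^sup>\<dagger> \<in> carrier_mat 2 2"
    using flipped_sector_carrier by auto
  have "diagonal_mat (flipped_sector * flipped_sector\<^sup>\<dagger>)"
    unfolding diagonal_mat_def carrier_matD[OF carrier]
    by (simp add: index_gram_flipped_sector del: index_mult_mat(1))
  from vn_entropy_diagonal[OF carrier this] show ?thesis
    by (simp add: gram_entropy_def sum_lessThan_2 index_gram_flipped_sector del: index_mult_mat(1))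
qed

lemma sectors_orthogonal:
  assumes "diagonal_mat (\<Phi> * \<Phi>\<^sup>\<dagger>)"
  shows "neutral_sector * flipped_sector\<^sup>\<dagger> = 0\<^sub>m 2 2"
proof (rule eq_matI)
  note N = neutral_sector_carrier and F = flipped_sector_carrier
  fix b b' assume "b < dim_row (0\<^sub>m 2 2 :: complex mat)" "b' < dim_col (0\<^sub>m 2 2 :: complex mat)"
  then have b: "b < 2" "b' < 2" by auto
  define z where "z = sqrt_q b * neutral_phase b b' * cnj (sqrt_q b' * (\<i> * s))"
  have "(neutral_sector * flipped_sector\<^sup>\<dagger>) $$ (b, b') = (\<Sum>k<2 * d. if k div d = b' then
      z * (\<Phi> $$ (b', k mod d) * cnj (\<Phi> $$ (1 - b', k mod d))) else 0)"
    unfolding index_mult_mat_sum[OF N mat_adjoint_carrier[OF F] b] using b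
    by (intro sum.cong) (auto simp: z_def neutral_sector_def flipped_sector_def)
  also have "\<dots> = (\<Sum>a<2. \<Sum>r<d. if a = b' then
      z * (\<Phi> $$ (b', r) * cnj (\<Phi> $$ (1 - b', r))) else 0)"
    by (rule sum_div_mod[OF dims_pos(1)])
  also have "\<dots> = z * (\<Phi> * \<Phi>\<^sup>\<dagger>) $$ (b', 1 - b')"
    using b(2) unfolding less_2_cases_iff
    by (elim disjE)
      (simp_all add: sum_lessThan_2 sum_distrib_left index_gram[OF \<Phi>] del: index_mult_mat(1))
  also have "(\<Phi> * \<Phi>\<^sup>\<dagger>) $$ (b', 1 - b') = 0"
    using assms \<Phi> b(2) unfolding diagonal_mat_def less_2_cases_iff by auto
  finally show "(neutral_sector * flipped_sector\<^sup>\<dagger>) $$ (b, b') = 0\<^sub>m 2 2 $$ (b, b')"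
    using b by simp
qed (use neutral_sector_carrier flipped_sector_carrier in auto)

theorem gram_entropy_swap_output_le:
  assumes "is_neutral_spectrum l m"
  shows "gram_entropy (swap_output \<theta> \<Phi> \<Psi>)
    \<le> eta ((sin \<theta>)^2 * (p 0 * q 1)) + eta ((sin \<theta>)^2 * (p 1 * q 0)) + eta l + eta m"
  using gram_entropy_append_rows_le[OF neutral_sector_carrier flipped_sector_carrier]
  by (simp add: gram_entropy_swap_output gram_entropy_neutral_sector[OF assms]
      gram_entropy_flipped_sector)

theorem gram_entropy_swap_output_diagonal:
  assumes "is_neutral_spectrum l m" and "diagonal_mat (\<Phi> * \<Phi>\<^sup>\<dagger>)"
  shows "gram_entropy (swap_output \<theta> \<Phi> \<Psi>)
    = eta ((sin \<theta>)^2 * (p 0 * q 1)) + eta ((sin \<theta>)^2 * (p 1 * q 0)) + eta l + eta m"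
  using gram_entropy_append_rows_orthogonal[OF neutral_sector_carrier flipped_sector_carrier]
    sectors_orthogonal[OF assms(2)]
  by (simp add: gram_entropy_swap_output gram_entropy_neutral_sector[OF assms(1)]
      gram_entropy_flipped_sector)

theorem gram_entropy_swap_output_le_max:
  defines "a \<equiv> (sin \<theta>)^2 / 4"
  assumes "0 < a"
  shows "gram_entropy (swap_output \<theta> \<Phi> \<Psi>) \<le> max (product_entropy a) (bell_entropy a) / ln 2"
proof -
  obtain l m where m: "0 \<le> m" "m \<le> l" and spectrum: "is_neutral_spectrum l m"
    by (rule neutral_spectrum_exists)
  have a: "a \<le> 1/4" "(sin \<theta>)^2 = 4 * a" by (simp_all add: a_def abs_square_le_1)
  have pq: "p 0 \<le> 1" "q 0 \<le> 1"
    using complement row_weight_nonneg[of \<Phi> 1] row_weight_nonneg[of \<Psi> 1] by simp_all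
  have "l + m = 1 - 4 * a * (p 0 * (1 - q 0) + (1 - p 0) * q 0)"
    "l * m = 16 * a * (1 - 3 * a) * (p 0 * (1 - q 0) * ((1 - p 0) * q 0))"
    using spectrum unfolding is_neutral_spectrum_def neutral_trace neutral_det complement a(2)
    by (simp_all add: algebra_simps)
  then have "eta_ln (4 * a * (p 0 * (1 - q 0))) + eta_ln (4 * a * ((1 - p 0) * q 0))
      + eta_ln l + eta_ln m \<le> max (product_entropy a) (bell_entropy a)"
    using \<open>0 < a\<close> a(1) pq m by (intro sector_entropy_le_max) auto
  then have "(eta_ln (4 * a * (p 0 * (1 - q 0))) + eta_ln (4 * a * ((1 - p 0) * q 0))
      + eta_ln l + eta_ln m) / ln 2 \<le> max (product_entropy a) (bell_entropy a) / ln 2"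
    by (simp add: divide_right_mono)
  then show ?thesis
    using gram_entropy_swap_output_le[OF spectrum] \<open>0 < a\<close> m pq unfolding complement a(2)
    by (simp add: eta_eq_eta_ln add_divide_distrib)
qed

end

section \<open>Entangling power\<close>

lemma coeff_mat_norm:
  assumes v: "unit_state (2 * d) v" and d: "0 < d"
  shows "row_weight (coeff_mat d v) 0 + row_weight (coeff_mat d v) 1 = 1"
proof -
  have "1 = (\<Sum>k<2 * d. (cmod (v $ (k div d * d + k mod d)))^2)"
    using v by (simp add: unit_state_def)
  also have "\<dots> = (\<Sum>a<2. \<Sum>r<d. (cmod (v $ (a * d + r)))^2)"
    by (rule sum_div_mod[OF d])
  finally show ?thesis by (simp add: sum_lessThan_2 row_weight_def coeff_mat_def)
qed

lemma diagonal_gram_coeff_mat: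
  assumes orth: "(\<Sum>r<d. v $ r * cnj (v $ (d + r))) = 0"
  shows "diagonal_mat (coeff_mat d v * (coeff_mat d v)\<^sup>\<dagger>)"
proof -
  let ?M = "coeff_mat d v * (coeff_mat d v)\<^sup>\<dagger>"
  have M: "?M \<in> carrier_mat 2 2" by (rule mult_carrier_mat[of _ _ d]) simp_all
  have "?M $$ (0, 1) = (\<Sum>r<d. v $ r * cnj (v $ (d + r)))"
    by (subst index_gram[OF coeff_mat_carrier]) (auto simp: coeff_mat_def)
  moreover have "?M $$ (1, 0) = cnj (\<Sum>r<d. v $ r * cnj (v $ (d + r)))"
    by (subst index_gram[OF coeff_mat_carrier]) (auto simp: coeff_mat_def mult.commute)
  ultimately show ?thesis
    unfolding diagonal_mat_def carrier_matD[OF M] orth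
    by (auto simp: less_2_cases_iff simp del: index_mult_mat(1))
qed

definition pauli_weight :: "real \<Rightarrow> real" where
  "pauli_weight x = (sin (2 * x))^2 / 4"

lemma sin_cos_double_pauli_weight:
  "(sin (2 * x))^2 = 4 * pauli_weight x" "(cos (2 * x))^2 = 1 - 4 * pauli_weight x"
  by (simp_all add: pauli_weight_def cos_squared_eq)

lemma pauli_weight_bounds: "0 \<le> pauli_weight x" "pauli_weight x \<le> 1/4"
  by (simp_all add: pauli_weight_def abs_square_le_1)

lemma cos_sin_square_eq_pauli_weight: "(cos x)^2 * (sin x)^2 = pauli_weight x"
  by (simp add: pauli_weight_def sin_double power2_eq_square)

lemma cos_sin_power6_eq_pauli_weight: "(cos x)^6 + (sin x)^6 = 1 - 3 * pauli_weight x"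
proof -
  have "p^6 + q^6 = (p^2 + q^2)^3 - 3 * (p^2 * q^2) * (p^2 + q^2)" for p q :: real
    by (simp add: eval_nat_numeral algebra_simps)
  from this[of "cos x" "sin x"] show ?thesis by (simp add: cos_sin_square_eq_pauli_weight)
qed

lemma shannon_product_entropy:
  "shannon [(cos (2 * x))^2, (sin (2 * x))^2] = product_entropy (pauli_weight x) / ln 2"
  using pauli_weight_bounds[of x]
  by (simp add: shannon_def product_entropy_def sin_cos_double_pauli_weight
      eta_eq_eta_ln add_divide_distrib)

lemma shannon_bell_entropy:
  "shannon [(cos x)^6 + (sin x)^6, (cos x)^2 * (sin x)^2,
      (cos x)^2 * (sin x)^2, (cos x)^2 * (sin x)^2]
    = bell_entropy (pauli_weight x) / ln 2"
  using pauli_weight_bounds[of x]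
  by (simp add: shannon_def bell_entropy_def cos_sin_square_eq_pauli_weight
      cos_sin_power6_eq_pauli_weight
      eta_eq_eta_ln add_divide_distrib)

theorem ent_out_Ugate_le:
  assumes d: "0 < dA" "0 < dB" and phi: "unit_state (2 * dA) phi" and psi: "unit_state (2 * dB) psi"
    and pos: "0 < pauli_weight x"
  shows "ent_out (Ugate x) dA dB phi psi
    \<le> max (product_entropy (pauli_weight x)) (bell_entropy (pauli_weight x)) / ln 2"
proof -
  let ?\<Phi> = "coeff_mat dA phi" and ?\<Psi> = "coeff_mat dB psi"
  obtain V \<Psi> where V: "unitary_mat 2 V" and \<Psi>: "\<Psi> \<in> carrier_mat 2 dB"
    and \<Psi>_diag: "diagonal_mat (\<Psi> * \<Psi>\<^sup>\<dagger>)" and \<Psi>_eq: "?\<Psi> = V * \<Psi>" "?\<Psi>\<^sup>\<dagger> * ?\<Psi> = \<Psi>\<^sup>\<dagger> * \<Psi>"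
    by (rule unitary_mult_diagonal_gram[OF coeff_mat_carrier])
  note V' = unitary_matD[OF V]
  define \<Phi> where "\<Phi> = V\<^sup>\<dagger> * ?\<Phi>"
  have \<Phi>: "\<Phi> \<in> carrier_mat 2 dA"
    unfolding \<Phi>_def by (rule mult_carrier_mat[OF V'(2) coeff_mat_carrier])
  have "V * \<Phi> = V * V\<^sup>\<dagger> * ?\<Phi>"
    unfolding \<Phi>_def by (rule assoc_mult_mat[OF V'(1,2) coeff_mat_carrier, symmetric])
  then have \<Phi>_eq: "?\<Phi> = V * \<Phi>"
    by (simp add: V'(4) left_mult_one_mat[OF coeff_mat_carrier])
  have "?\<Phi>\<^sup>\<dagger> * ?\<Phi> = \<Phi>\<^sup>\<dagger> * \<Phi>"
    unfolding \<Phi>_eq by (rule gram_mult_isometry(2)[OF V'(1) \<Phi> V'(3)])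
  then interpret diagonal_swap_input "2 * x" \<Phi> \<Psi> dA dB
    using \<Phi> \<Psi> \<Psi>_diag sum_row_weight_gram_cong[OF coeff_mat_carrier \<Phi>]
      sum_row_weight_gram_cong[OF coeff_mat_carrier \<Psi> \<Psi>_eq(2)]
      coeff_mat_norm[OF phi d(1)] coeff_mat_norm[OF psi d(2)]
    by unfold_locales (simp_all add: sum_lessThan_2)
  have "ent_out (Ugate x) dA dB phi psi = gram_entropy (swap_output (2 * x) \<Phi> \<Psi>)"
    unfolding ent_out_Ugate[OF d(1)] \<Phi>_eq \<Psi>_eq(1)
    by (rule gram_entropy_swap_output_local_unitary[OF V \<Phi> \<Psi>])
  then show ?thesis
    using gram_entropy_swap_output_le_max pos by (simp add: pauli_weight_def)
qed

lemma ent_out_Ugate_diagonal: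
  fixes x :: real
  assumes d: "0 < dA" "0 < dB" and phi: "unit_state (2 * dA) phi" and psi: "unit_state (2 * dB) psi"
    and diag: "diagonal_mat (coeff_mat dA phi * (coeff_mat dA phi)\<^sup>\<dagger>)"
      "diagonal_mat (coeff_mat dB psi * (coeff_mat dB psi)\<^sup>\<dagger>)"
    and p: "row_weight (coeff_mat dA phi) 0 = p" and q: "row_weight (coeff_mat dB psi) 0 = q"
  defines "a \<equiv> pauli_weight x"
  assumes sum_eq: "l + m = 1 - 4 * a * (p * (1 - q) + (1 - p) * q)"
    and prod_eq: "l * m = 16 * a * (1 - 3 * a) * (p * (1 - q) * ((1 - p) * q))"
  shows "ent_out (Ugate x) dA dB phi psi
    = eta (4 * a * (p * (1 - q))) + eta (4 * a * ((1 - p) * q)) + eta l + eta m"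
proof -
  interpret diagonal_swap_input "2 * x" "coeff_mat dA phi" "coeff_mat dB psi" dA dB
    using diag coeff_mat_norm[OF phi d(1)] coeff_mat_norm[OF psi d(2)] by unfold_locales simp_all
  have S: "(sin (2 * x))^2 = 4 * a" unfolding a_def by (rule sin_cos_double_pauli_weight)
  have "is_neutral_spectrum l m"
    unfolding is_neutral_spectrum_def sum_eq prod_eq neutral_trace neutral_det complement p q S
    by (simp add: algebra_simps)
  from gram_entropy_swap_output_diagonal[OF this diag(1)] show ?thesis
    unfolding ent_out_Ugate[OF d(1)] complement p q S .
qed

lemma unit_states: "unit_state (2 * 2) ket00" "unit_state (2 * 2) ket11" "unit_state (2 * 2) bell"
  by (simp_all add: unit_state_def ket00_def ket11_def bell_def lessThan_Suc numeral_eq_Suc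
      norm_divide power_divide)

lemma ent_out_ket00_ket11:
  "ent_out (Ugate x) 2 2 ket00 ket11 = shannon [(cos (2 * x))^2, (sin (2 * x))^2]"
proof -
  let ?a = "pauli_weight x"
  have "diagonal_mat (coeff_mat 2 ket00 * (coeff_mat 2 ket00)\<^sup>\<dagger>)"
    "diagonal_mat (coeff_mat 2 ket11 * (coeff_mat 2 ket11)\<^sup>\<dagger>)"
    by (simp_all add: diagonal_gram_coeff_mat ket00_def ket11_def sum_lessThan_2)
  moreover have "row_weight (coeff_mat 2 ket00) 0 = 1" "row_weight (coeff_mat 2 ket11) 0 = 0"
    by (simp_all add: row_weight_def coeff_mat_def ket00_def ket11_def sum_lessThan_2)
  ultimately have "ent_out (Ugate x) 2 2 ket00 ket11
      = eta (4 * ?a * (1 * (1 - 0))) + eta (4 * ?a * ((1 - 1) * 0)) + eta (1 - 4 * ?a) + eta 0"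
    by (intro ent_out_Ugate_diagonal unit_states) simp_all
  then show ?thesis
    unfolding sin_cos_double_pauli_weight by (simp add: shannon_def eta_def)
qed

lemma ent_out_bell_bell:
  "ent_out (Ugate x) 2 2 bell bell
    = shannon [(cos x)^6 + (sin x)^6, (cos x)^2 * (sin x)^2,
        (cos x)^2 * (sin x)^2, (cos x)^2 * (sin x)^2]"
proof -
  let ?a = "pauli_weight x"
  have "diagonal_mat (coeff_mat 2 bell * (coeff_mat 2 bell)\<^sup>\<dagger>)"
    by (simp add: diagonal_gram_coeff_mat bell_def sum_lessThan_2)
  moreover have "row_weight (coeff_mat 2 bell) 0 = 1/2"
    by (simp add: row_weight_def coeff_mat_def bell_def sum_lessThan_2 norm_divide power_divide)
  ultimately have "ent_out (Ugate x) 2 2 bell bell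
      = eta (4 * ?a * (1/2 * (1 - 1/2))) + eta (4 * ?a * ((1 - 1/2) * (1/2)))
        + eta (1 - 3 * ?a) + eta ?a"
    by (intro ent_out_Ugate_diagonal unit_states) (simp_all add: algebra_simps)
  then show ?thesis
    unfolding cos_sin_square_eq_pauli_weight cos_sin_power6_eq_pauli_weight
    by (simp add: shannon_def)
qed

theorem entangling_power_Ugate:
  assumes "0 < pauli_weight x"
  shows "entangling_power (Ugate x)
    = max (product_entropy (pauli_weight x)) (bell_entropy (pauli_weight x)) / ln 2"
  unfolding entangling_power_def
proof (rule cSup_eq_maximum)
  let ?E = "{ent_out (Ugate x) dRA dRB phi psi | dRA dRB phi psi.
    dRA \<ge> 1 \<and> dRB \<ge> 1 \<and> unit_state (2 * dRA) phi \<and> unit_state (2 * dRB) psi}"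
  have "ent_out (Ugate x) 2 2 ket00 ket11 \<in> ?E" "ent_out (Ugate x) 2 2 bell bell \<in> ?E"
    using unit_states by (force simp del: mult_2)+
  then show "max (product_entropy (pauli_weight x)) (bell_entropy (pauli_weight x)) / ln 2 \<in> ?E"
    unfolding ent_out_ket00_ket11 ent_out_bell_bell shannon_product_entropy shannon_bell_entropy
    by (simp only: max_def simp_thms split: if_split)
qed (use ent_out_Ugate_le assms in auto)

lemma pauli_weight_pos: "0 < x \<Longrightarrow> x < pi / 2 \<Longrightarrow> 0 < pauli_weight x"
  using sin_gt_zero[of "2 * x"] by (simp add: pauli_weight_def)

lemma pauli_weight_mono:
  assumes "0 \<le> x" "x \<le> y" "y \<le> pi / 4"
  shows "pauli_weight x \<le> pauli_weight y"
proof -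
  have "sin (2 * x) \<le> sin (2 * y)" "0 \<le> sin (2 * x)"
    using assms by (intro sin_monotone_2pi_le sin_ge_zero; simp)+
  then show ?thesis by (simp add: pauli_weight_def power_mono)
qed

lemma pauli_weight_less:
  assumes "0 \<le> x" "x < pi / 4"
  shows "pauli_weight x < 1/4"
proof -
  have "sin (2 * x) < sin (pi / 2)" "0 \<le> sin (2 * x)"
    using assms by (intro sin_monotone_2pi sin_ge_zero; simp)+
  then have "(sin (2 * x))^2 < 1^2" by (intro power_strict_mono) auto
  then show ?thesis by (simp add: pauli_weight_def)
qed

theorem theorem2:
  fixes x x0 :: real
  assumes x0_approx: "0.1 < x0" "x0 < 0.11"
    and x0_root: "shannon [(cos (2 * x0))^2, (sin (2 * x0))^2] =
       shannon [(cos x0)^6 + (sin x0)^6, (cos x0)^2 * (sin x0)^2,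
                (cos x0)^2 * (sin x0)^2, (cos x0)^2 * (sin x0)^2]"
    and x_range: "0 < x" "x \<le> pi / 4"
  shows "(x \<le> x0 \<longrightarrow>
            entangling_power (Ugate x) = shannon [(cos (2 * x))^2, (sin (2 * x))^2] \<and>
            ent_out (Ugate x) 2 2 ket00 ket11 = shannon [(cos (2 * x))^2, (sin (2 * x))^2])
       \<and> (x0 \<le> x \<longrightarrow>
            entangling_power (Ugate x) =
              shannon [(cos x)^6 + (sin x)^6, (cos x)^2 * (sin x)^2,
                       (cos x)^2 * (sin x)^2, (cos x)^2 * (sin x)^2] \<and>
            ent_out (Ugate x) 2 2 bell bell =
              shannon [(cos x)^6 + (sin x)^6, (cos x)^2 * (sin x)^2,
                       (cos x)^2 * (sin x)^2, (cos x)^2 * (sin x)^2])"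
proof -
  let ?w = "pauli_weight x" and ?w_root = "pauli_weight x0"
  have crossing: "bell_entropy ?w_root = product_entropy ?w_root"
    using x0_root unfolding shannon_product_entropy shannon_bell_entropy by simp
  have x0: "0 < x0" "x0 < pi / 4" using x0_approx pi_ge_two by auto
  have pos: "0 < ?w" "0 < ?w_root" using x_range x0 by (auto intro: pauli_weight_pos)
  have "bell_entropy ?w \<le> product_entropy ?w" if "x \<le> x0"
    using that x_range x0 pos
    by (intro bell_entropy_le_product_entropy[OF crossing] pauli_weight_less pauli_weight_mono) auto
  moreover have "product_entropy ?w \<le> bell_entropy ?w" if "x0 \<le> x"
    using that x_range x0 pos pauli_weight_bounds(2)[of x]
    by (intro product_entropy_le_bell_entropy[OF crossing] pauli_weight_mono) auto
  ultimately show ?thesis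
    by (auto simp: entangling_power_Ugate[OF pos(1)] ent_out_ket00_ket11 ent_out_bell_bell
        shannon_product_entropy shannon_bell_entropy max_def)
qed

end
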